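(* Let $g>1$. Suppose $p\in\mathbb C\langle X_{ij},X_{ij}^{\intercal}:1\le i,j\le g\rangle$ is of degree $u\ge1$ and has $v$ terms. If $p$ vanishes on all $g$-partitioned unitaries with blocks of size $\lceil\tfrac g2uv\rceil$, then $$p\in\mathcal U=(I_g-XX^{\intercal},\,I_g-X^{\intercal}X).$$
   Context: $\mathbb C\langle X_{ij},X_{ij}^{\intercal}:1\le i,j\le g\rangle$ is the free associative unital $\mathbb C$-algebra in $2g^2$ freely noncommuting letters with the conjugate-linear involution exchanging $X_{ij}$ and $X_{ij}^{\intercal}$. $X=(X_{ij})_{ij}$ is the $g\times g$ matrix of letters, $X^{\intercal}$ is the $g\times g$ matrix with $(i,j)$ entry $(X_{ji})^{\intercal}$, and $\mathcal U$ is the two-sided ideal generated by the $2g^2$ entries of $I_g-XX^{\intercal}$ and $I_g-X^{\intercal}X$. A $g$-partitioned unitary with blocks of size $n$ is a $g^2$-tuple $A=(A_{ij})_{i,j=1}^g$ of matrices $A_{ij}\in M_n(\mathbb C)$ such that the $gn\times gn$ block matrix $A$ satisfies $A^*A=I$. The evaluation of $p$ at $A$ replaces $X_{ij}$ by $A_{ij}$ and $X_{ij}^{\intercal}$ by the conjugate transpose $A_{ij}^*$. The number of terms of $p$ is the number of words with nonzero coefficient. *)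

theory Defs
  imports
    "HOL-Library.Poly_Mapping"
    "HOL-Algebra.Ideal"
    "Jordan_Normal_Form.Schur_Decomposition"
begin

text \<open>
  The free monoid, written additively because multiplication on
  \<^typ>\<open>('m, 'c) poly_mapping\<close> is the convolution product for a
  \<^class>\<open>monoid_add\<close> of exponents; addition of words is concatenation.
\<close>

datatype 'a free_word = Word (letters: "'a list")

instantiation free_word :: (type) monoid_add
begin

definition zero_free_word :: "'a free_word" where
  "0 = Word []"

definition plus_free_word :: "'a free_word \<Rightarrow> 'a free_word \<Rightarrow> 'a free_word" where
  "a + b = Word (letters a @ letters b)"

instance
  by standard (auto simp: zero_free_word_def plus_free_word_def)

end

text \<open>
  Indices run over \<open>{0..<g}\<close> instead of \<open>{1..g}\<close>. \<open>Var i j\<close> and \<open>VarT i j\<close> stand for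
  \<open>X\<^sub>i\<^sub>j\<close> and its formal transpose \<open>(X\<^sub>i\<^sub>j)\<^sup>T\<close> (so \<open>VarT i j\<close> is the \<open>(j, i)\<close> entry of
  the matrix \<open>X\<^sup>T\<close>).
\<close>

datatype letter = Var nat nat | VarT nat nat

fun letter_ok :: "nat \<Rightarrow> letter \<Rightarrow> bool" where
  "letter_ok g (Var i j) \<longleftrightarrow> i < g \<and> j < g"
| "letter_ok g (VarT i j) \<longleftrightarrow> i < g \<and> j < g"

fun letter_star :: "letter \<Rightarrow> letter" where
  "letter_star (Var i j) = VarT i j"
| "letter_star (VarT i j) = Var i j"

type_synonym nc_poly = "(letter free_word, complex) poly_mapping"

definition free_algebra :: "nat \<Rightarrow> nc_poly ring" where
  "free_algebra g =
     \<lparr>carrier = {p. \<forall>w\<in>Poly_Mapping.keys p. \<forall>l\<in>set (letters w). letter_ok g l},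
      monoid.mult = (*), one = 1, zero = 0, add = (+)\<rparr>"

definition nc_letter :: "letter \<Rightarrow> nc_poly" where
  "nc_letter l = Poly_Mapping.single (Word [l]) 1"

definition nc_star :: "nc_poly \<Rightarrow> nc_poly" where
  "nc_star p =
     (\<Sum>w\<in>Poly_Mapping.keys p. Poly_Mapping.single (Word (rev (map letter_star (letters w)))) (cnj (Poly_Mapping.lookup p w)))"

text \<open>The zero polynomial is given degree 0.\<close>

definition nc_degree :: "nc_poly \<Rightarrow> nat" where
  "nc_degree p = Max (insert 0 ((\<lambda>w. length (letters w)) ` Poly_Mapping.keys p))"

definition nc_terms :: "nc_poly \<Rightarrow> nat" where
  "nc_terms p = card (Poly_Mapping.keys p)"

definition X_mat :: "nat \<Rightarrow> nc_poly mat" where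
  "X_mat g = mat g g (\<lambda>(i, j). nc_letter (Var i j))"

definition XT_mat :: "nat \<Rightarrow> nc_poly mat" where
  "XT_mat g = mat g g (\<lambda>(i, j). nc_star (X_mat g $$ (j, i)))"

definition unitary_ideal :: "nat \<Rightarrow> nc_poly set" where
  "unitary_ideal g =
     genideal (free_algebra g)
       (elements_mat (1\<^sub>m g - X_mat g * XT_mat g) \<union> elements_mat (1\<^sub>m g - XT_mat g * X_mat g))"

definition block_mat :: "nat \<Rightarrow> nat \<Rightarrow> (nat \<Rightarrow> nat \<Rightarrow> complex mat) \<Rightarrow> complex mat" where
  "block_mat g n A =
     mat (g * n) (g * n) (\<lambda>(r, c). A (r div n) (c div n) $$ (r mod n, c mod n))"

definition partitioned_unitary :: "nat \<Rightarrow> nat \<Rightarrow> (nat \<Rightarrow> nat \<Rightarrow> complex mat) \<Rightarrow> bool" where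
  "partitioned_unitary g n A \<longleftrightarrow>
     (\<forall>i<g. \<forall>j<g. A i j \<in> carrier_mat n n) \<and>
     mat_adjoint (block_mat g n A) * block_mat g n A = 1\<^sub>m (g * n)"

fun eval_letter :: "(nat \<Rightarrow> nat \<Rightarrow> complex mat) \<Rightarrow> letter \<Rightarrow> complex mat" where
  "eval_letter A (Var i j) = A i j"
| "eval_letter A (VarT i j) = mat_adjoint (A i j)"

definition eval_word :: "nat \<Rightarrow> (nat \<Rightarrow> nat \<Rightarrow> complex mat) \<Rightarrow> letter free_word \<Rightarrow> complex mat" where
  "eval_word n A w = foldr (\<lambda>l M. eval_letter A l * M) (letters w) (1\<^sub>m n)"

text \<open>
  The linear combination of the values of the words is taken entrywise, since
  \<^typ>\<open>complex mat\<close> carries no addition monoid over which one could sum.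
\<close>

definition nc_eval :: "nat \<Rightarrow> (nat \<Rightarrow> nat \<Rightarrow> complex mat) \<Rightarrow> nc_poly \<Rightarrow> complex mat" where
  "nc_eval n A p =
     mat n n (\<lambda>(a, b). \<Sum>w\<in>Poly_Mapping.keys p. Poly_Mapping.lookup p w * (eval_word n A w $$ (a, b)))"

lemma free_algebra_simps [simp]:
  "p \<in> carrier (free_algebra g) \<longleftrightarrow> (\<forall>w\<in>Poly_Mapping.keys p. \<forall>l\<in>set (letters w). letter_ok g l)"
  "monoid.mult (free_algebra g) = (*)"
  "one (free_algebra g) = 1"
  "zero (free_algebra g) = 0"
  "add (free_algebra g) = (+)"
  by (simp_all add: free_algebra_def)

lemma keys_times_words:
  fixes p q :: nc_poly
  assumes "w \<in> Poly_Mapping.keys (p * q)"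
  obtains a b where "a \<in> Poly_Mapping.keys p" "b \<in> Poly_Mapping.keys q" "letters w = letters a @ letters b"
  using Poly_Mapping.keys_mult[of p q] assms by (fastforce simp: plus_free_word_def)

lemma ring_free_algebra: "ring (free_algebra g)"
proof (rule ringI)
  show "abelian_group (free_algebra g)"
  proof (rule abelian_groupI)
    fix x y assume "x \<in> carrier (free_algebra g)" "y \<in> carrier (free_algebra g)"
    then show "x \<oplus>\<^bsub>free_algebra g\<^esub> y \<in> carrier (free_algebra g)"
      using Poly_Mapping.keys_add[of x y] by auto
  next
    fix x assume x: "x \<in> carrier (free_algebra g)"
    show "\<exists>y\<in>carrier (free_algebra g). y \<oplus>\<^bsub>free_algebra g\<^esub> x = \<zero>\<^bsub>free_algebra g\<^esub>"
      using x by (intro bexI[of _ "- x"]) (auto simp: Poly_Mapping.keys.rep_eq)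
  qed (auto simp: add.assoc add.commute)
  show "Group.monoid (free_algebra g)"
  proof (rule monoidI)
    fix x y assume "x \<in> carrier (free_algebra g)" "y \<in> carrier (free_algebra g)"
    then show "x \<otimes>\<^bsub>free_algebra g\<^esub> y \<in> carrier (free_algebra g)"
      by (auto elim!: keys_times_words)
  next
    show "\<one>\<^bsub>free_algebra g\<^esub> \<in> carrier (free_algebra g)"
      by (auto simp: zero_free_word_def)
  qed (auto simp: mult.assoc)
qed (auto simp: algebra_simps)

lemma nc_star_letter: "nc_star (nc_letter l) = nc_letter (letter_star l)"
  by (simp add: nc_star_def nc_letter_def)

lemma XT_mat_index: "i < g \<Longrightarrow> j < g \<Longrightarrow> XT_mat g $$ (i, j) = nc_letter (VarT j i)"
  by (simp add: XT_mat_def X_mat_def nc_star_letter)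

lemma mat_adjoint_index:
  fixes B :: "complex mat"
  assumes "i < dim_col B" "j < dim_row B"
  shows "mat_adjoint B $$ (i, j) = cnj (B $$ (j, i))"
  using assms by (simp add: mat_adjoint_def mat_of_rows_def conjugate_complex_def)

end

theory Submission
  imports Defs
begin

text \<open>
  Modulo \<open>\<U>\<close> the letters \<open>X\<^sup>T\<close> are the entries of \<open>X\<^sup>-\<^sup>1\<close>, so the natural points at which to
  evaluate are pairs of mutually inverse block matrices \<open>(X, Z)\<close>, of which the pairs \<open>(U, U\<^sup>*)\<close>
  form a Zariski dense part. The proof produces, for every \<open>p\<close> of degree \<open>u\<close> outside \<open>\<U>\<close>, an
  inverse pair of a size that depends on \<open>u\<close> alone at which \<open>p\<close> does not vanish.

  Density (\<open>vanishes_on_inverse_pairs\<close>): after multiplication of \<open>X\<close> by a scalar of modulus 1 the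
  matrix \<open>W = (X + 1)\<^sup>-\<^sup>1\<close> exists, and \<open>X = W\<^sup>-\<^sup>1 - 1\<close> is unitary exactly if \<open>W - 1/2\<close> is
  skew-Hermitian. Any \<open>W - 1/2\<close> has the form \<open>K\<^sub>1 + \<i> K\<^sub>2\<close> with \<open>K\<^sub>1\<close> and \<open>K\<^sub>2\<close> skew-Hermitian,
  so the line \<open>1/2 + K\<^sub>1 + t K\<^sub>2\<close> gives unitary matrices for real \<open>t\<close> and the given \<open>X\<close> at
  \<open>t = \<i>\<close>; along it an entry of \<open>p\<close> is a rational function of \<open>t\<close> with infinitely many zeros.

  Normal forms (\<open>reducible_degree\<close>): solving each defining relation for its term with inner index 0
  rewrites \<open>p\<close> modulo \<open>\<U>\<close>, without raising its degree, into a combination \<open>q\<close> of words in which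
  no letter \<open>X\<^sub>i\<^sub>0\<close> meets a following \<open>(X\<^sup>T)\<^sub>0\<^sub>k\<close> and no \<open>(X\<^sup>T)\<^sub>i\<^sub>0\<close> a following \<open>X\<^sub>0\<^sub>k\<close>. It remains
  to show that \<open>q = 0\<close>.

  Separation (\<open>top_coefficient_zero\<close>): let \<open>d\<close> be the degree of \<open>q\<close>. On a space with basis
  \<open>e\<^sub>0, \<dots>, e\<^sub>d\<close> one lets every letter act by an upper bidiagonal matrix. Among the words of
  length at most \<open>d\<close> only those of length \<open>d\<close> then contribute to the entry at \<open>(0, d)\<close>, and their
  values are products of superdiagonal entries. If the
  superdiagonal part of the block matrix \<open>X\<close> is \<open>x\<^sub>k \<otimes> y\<^sub>k\<^sub>+\<^sub>1\<close> at the \<open>k\<close>-th step and its diagonal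
  part there is an invertible matrix \<open>Q\<^sub>k\<close>, then \<open>Z = X\<^sup>-\<^sup>1\<close> is again bidiagonal as soon as
  \<open>y\<^sub>k Q\<^sub>k\<^sup>-\<^sup>1 x\<^sub>k = 0\<close>, and its superdiagonal part has the same shape. The value of a word thus factors
  over its junctions, the places between consecutive letters, and the data at different junctions
  can be chosen independently. The only linear condition that a junction imposes on the pairs of
  adjacent letters is the one that normal words avoid by leaving out the pair with inner indices 0,
  so linear combinations of junction data detect any single pair (\<open>junction_span_unit\<close>).
  By multilinearity they detect any single normal word.

  A chain needs \<open>d + 1 \<le> u + 1\<close> states, which the prescribed size provides if \<open>p\<close> has at least two
  terms. A monomial does not vanish at an inverse pair all of whose blocks are nonzero scalar matrices
  (\<open>scalar_rep_word_nonzero\<close>).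
\<close>

section \<open>Evaluation along a representation of the letters\<close>

text \<open>
  The entry at \<open>(a, b)\<close> of the product of the \<open>n \<times> n\<close> matrices \<open>E l\<close> along a word. Entries are used
  in place of matrices so that coefficients may be taken from any commutative ring; below these are
  complex numbers and, along a line of matrices, polynomials.
\<close>

fun word_entry :: "nat \<Rightarrow> (letter \<Rightarrow> nat \<Rightarrow> nat \<Rightarrow> 'a::comm_ring_1) \<Rightarrow> letter list \<Rightarrow> nat \<Rightarrow> nat \<Rightarrow> 'a" where
  "word_entry n E [] a b = of_bool (a = b)"
| "word_entry n E (l # w) a b = (\<Sum>c<n. E l a c * word_entry n E w c b)"

definition poly_entry :: "nat \<Rightarrow> (letter \<Rightarrow> nat \<Rightarrow> nat \<Rightarrow> complex) \<Rightarrow> nc_poly \<Rightarrow> nat \<Rightarrow> nat \<Rightarrow> complex" where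
  "poly_entry n E p a b =
     (\<Sum>w\<in>Poly_Mapping.keys p. Poly_Mapping.lookup p w * word_entry n E (letters w) a b)"

text \<open>
  The block matrices with blocks \<open>E (Var i j)\<close> and, in transposed block position, \<open>E (VarT i j)\<close>
  are inverse to each other.
\<close>

definition inverse_pair_rep :: "nat \<Rightarrow> nat \<Rightarrow> (letter \<Rightarrow> nat \<Rightarrow> nat \<Rightarrow> complex) \<Rightarrow> bool" where
  "inverse_pair_rep g n E \<longleftrightarrow>
     (\<forall>i<g. \<forall>k<g. \<forall>a<n. \<forall>b<n.
        (\<Sum>j<g. \<Sum>c<n. E (Var i j) a c * E (VarT k j) c b) = of_bool (i = k \<and> a = b) \<and>
        (\<Sum>j<g. \<Sum>c<n. E (VarT j i) a c * E (Var j k) c b) = of_bool (i = k \<and> a = b))"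

lemma word_entry_append:
  assumes "a < n"
  shows "word_entry n E (u @ w) a b = (\<Sum>c<n. word_entry n E u a c * word_entry n E w c b)"
  using assms
proof (induction u arbitrary: a)
  case Nil
  then show ?case
    by (simp add: of_bool_def if_distrib[of "\<lambda>x. x * _"] cong: if_cong)
next
  case (Cons l u)
  have "word_entry n E ((l # u) @ w) a b =
      (\<Sum>d<n. \<Sum>c<n. E l a d * (word_entry n E u d c * word_entry n E w c b))"
    using Cons.IH by (simp add: sum_distrib_left)
  also have "\<dots> = (\<Sum>c<n. \<Sum>d<n. E l a d * (word_entry n E u d c * word_entry n E w c b))"
    by (rule sum.swap)
  finally show ?case
    by (simp add: sum_distrib_right mult.assoc)
qed

lemma poly_entry_superset:
  assumes "finite S" "Poly_Mapping.keys p \<subseteq> S"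
  shows "poly_entry n E p a b = (\<Sum>w\<in>S. Poly_Mapping.lookup p w * word_entry n E (letters w) a b)"
  unfolding poly_entry_def using assms
  by (intro sum.mono_neutral_left) (auto simp: in_keys_iff)

lemma poly_entry_zero [simp]: "poly_entry n E 0 a b = 0"
  by (simp add: poly_entry_def)

lemma poly_entry_single [simp]:
  "poly_entry n E (Poly_Mapping.single w c) a b = c * word_entry n E (letters w) a b"
  by (simp add: poly_entry_def)

lemma poly_entry_add: "poly_entry n E (p + q) a b = poly_entry n E p a b + poly_entry n E q a b"
proof -
  let ?S = "Poly_Mapping.keys p \<union> Poly_Mapping.keys q"
  have "poly_entry n E (p + q) a b =
      (\<Sum>w\<in>?S. Poly_Mapping.lookup (p + q) w * word_entry n E (letters w) a b)"
    by (rule poly_entry_superset) (auto simp: Poly_Mapping.keys_add)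
  moreover have "poly_entry n E p a b = (\<Sum>w\<in>?S. Poly_Mapping.lookup p w * word_entry n E (letters w) a b)"
    by (rule poly_entry_superset) auto
  moreover have "poly_entry n E q a b = (\<Sum>w\<in>?S. Poly_Mapping.lookup q w * word_entry n E (letters w) a b)"
    by (rule poly_entry_superset) auto
  ultimately show ?thesis
    by (simp add: lookup_add distrib_right sum.distrib)
qed

lemma poly_entry_uminus: "poly_entry n E (- p) a b = - poly_entry n E p a b"
  using poly_entry_add[of n E p "- p" a b] by (simp add: eq_neg_iff_add_eq_0 add.commute)

lemma poly_entry_diff: "poly_entry n E (p - q) a b = poly_entry n E p a b - poly_entry n E q a b"
  using poly_entry_add[of n E p "- q" a b] by (simp add: poly_entry_uminus)

lemma poly_entry_sum: "poly_entry n E (\<Sum>x\<in>S. f x) a b = (\<Sum>x\<in>S. poly_entry n E (f x) a b)"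
  by (induction S rule: infinite_finite_induct) (simp_all add: poly_entry_add)

lemma sum_of_monomials:
  "p = (\<Sum>w\<in>Poly_Mapping.keys p. Poly_Mapping.single w (Poly_Mapping.lookup p w))"
  by (rule poly_mapping_eqI)
    (simp add: lookup_sum lookup_single when_def in_keys_iff)

lemma poly_entry_mult:
  assumes "a < n"
  shows "poly_entry n E (p * q) a b = (\<Sum>c<n. poly_entry n E p a c * poly_entry n E q c b)"
proof -
  let ?K = "Poly_Mapping.keys" and ?L = "Poly_Mapping.lookup"
  have "p * q = (\<Sum>u\<in>?K p. \<Sum>w\<in>?K q. Poly_Mapping.single (u + w) (?L p u * ?L q w))"
    by (subst sum_of_monomials[of p], subst sum_of_monomials[of q])
      (simp add: sum_product mult_single)
  then have "poly_entry n E (p * q) a b =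
      (\<Sum>u\<in>?K p. \<Sum>w\<in>?K q. ?L p u * ?L q w * word_entry n E (letters u @ letters w) a b)"
    by (simp add: poly_entry_sum plus_free_word_def)
  also have "\<dots> = (\<Sum>u\<in>?K p. \<Sum>w\<in>?K q. \<Sum>c<n.
      (?L p u * word_entry n E (letters u) a c) * (?L q w * word_entry n E (letters w) c b))"
    by (simp add: word_entry_append[OF assms] sum_distrib_left mult_ac)
  also have "\<dots> = (\<Sum>u\<in>?K p. \<Sum>c<n. \<Sum>w\<in>?K q.
      (?L p u * word_entry n E (letters u) a c) * (?L q w * word_entry n E (letters w) c b))"
    by (intro sum.cong refl sum.swap)
  also have "\<dots> = (\<Sum>c<n. \<Sum>u\<in>?K p. \<Sum>w\<in>?K q.
      (?L p u * word_entry n E (letters u) a c) * (?L q w * word_entry n E (letters w) c b))"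
    by (rule sum.swap)
  finally show ?thesis
    by (simp add: poly_entry_def sum_product)
qed

section \<open>The unitary ideal and its relations\<close>

lemma X_mat_XT_mat_entries:
  assumes "i < g" "j < g"
  shows "(X_mat g * XT_mat g) $$ (i, j) =
      (\<Sum>k<g. Poly_Mapping.single (Word [Var i k, VarT j k]) 1)"
    and "(XT_mat g * X_mat g) $$ (i, j) =
      (\<Sum>k<g. Poly_Mapping.single (Word [VarT k i, Var k j]) 1)"
proof -
  have dims: "X_mat g \<in> carrier_mat g g" "XT_mat g \<in> carrier_mat g g"
    by (simp_all add: X_mat_def XT_mat_def)
  have X: "X_mat g $$ (r, s) = nc_letter (Var r s)" if "r < g" "s < g" for r s
    using that by (simp add: X_mat_def)
  show "(X_mat g * XT_mat g) $$ (i, j) =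
      (\<Sum>k<g. Poly_Mapping.single (Word [Var i k, VarT j k]) 1)"
    using assms dims
    by (auto simp: scalar_prod_def X XT_mat_index nc_letter_def mult_single plus_free_word_def
        lessThan_atLeast0 intro!: sum.cong)
  show "(XT_mat g * X_mat g) $$ (i, j) =
      (\<Sum>k<g. Poly_Mapping.single (Word [VarT k i, Var k j]) 1)"
    using assms dims
    by (auto simp: scalar_prod_def X XT_mat_index nc_letter_def mult_single plus_free_word_def
        lessThan_atLeast0 intro!: sum.cong)
qed

definition row_relation :: "nat \<Rightarrow> nat \<Rightarrow> nat \<Rightarrow> nc_poly" where
  "row_relation g i k =
     of_bool (i = k) - (\<Sum>j<g. Poly_Mapping.single (Word [Var i j, VarT k j]) 1)"

definition col_relation :: "nat \<Rightarrow> nat \<Rightarrow> nat \<Rightarrow> nc_poly" where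
  "col_relation g i k =
     of_bool (i = k) - (\<Sum>j<g. Poly_Mapping.single (Word [VarT j i, Var j k]) 1)"

lemma unitary_relations_entries:
  "elements_mat (1\<^sub>m g - X_mat g * XT_mat g) = {row_relation g i k | i k. i < g \<and> k < g}"
  "elements_mat (1\<^sub>m g - XT_mat g * X_mat g) = {col_relation g i k | i k. i < g \<and> k < g}"
proof -
  have dims: "dim_row (X_mat g * XT_mat g) = g" "dim_col (X_mat g * XT_mat g) = g"
     "dim_row (XT_mat g * X_mat g) = g" "dim_col (XT_mat g * X_mat g) = g"
    by (simp_all add: X_mat_def XT_mat_def)
  have 1: "(1\<^sub>m g - X_mat g * XT_mat g) $$ (i, k) = row_relation g i k" if "i < g" "k < g" for i k
    using that dims by (simp add: row_relation_def X_mat_XT_mat_entries del: index_mult_mat(1))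
  have 2: "(1\<^sub>m g - XT_mat g * X_mat g) $$ (i, k) = col_relation g i k" if "i < g" "k < g" for i k
    using that dims by (simp add: col_relation_def X_mat_XT_mat_entries del: index_mult_mat(1))
  show "elements_mat (1\<^sub>m g - X_mat g * XT_mat g) = {row_relation g i k | i k. i < g \<and> k < g}"
    unfolding elements_mat_def using 1 dims
    by (auto simp del: index_minus_mat(1) index_mult_mat(1)) metis
  show "elements_mat (1\<^sub>m g - XT_mat g * X_mat g) = {col_relation g i k | i k. i < g \<and> k < g}"
    unfolding elements_mat_def using 2 dims
    by (auto simp del: index_minus_mat(1) index_mult_mat(1)) metis
qed

lemma row_relation_carrier:
  assumes "i < g" "k < g"
  shows "row_relation g i k \<in> carrier (free_algebra g)"
proof -
  have "Poly_Mapping.keys (row_relation g i k) \<subseteq>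
     Poly_Mapping.keys (of_bool (i = k) :: nc_poly) \<union>
     (\<Union>j<g. Poly_Mapping.keys (Poly_Mapping.single (Word [Var i j, VarT k j]) (1::complex)))"
    unfolding row_relation_def by (rule order_trans[OF keys_diff Un_mono[OF order_refl keys_sum]])
  then show ?thesis using assms
    by (fastforce simp: of_bool_def zero_free_word_def split: if_splits)
qed

lemma col_relation_carrier:
  assumes "i < g" "k < g"
  shows "col_relation g i k \<in> carrier (free_algebra g)"
proof -
  have "Poly_Mapping.keys (col_relation g i k) \<subseteq>
     Poly_Mapping.keys (of_bool (i = k) :: nc_poly) \<union>
     (\<Union>j<g. Poly_Mapping.keys (Poly_Mapping.single (Word [VarT j i, Var j k]) (1::complex)))"
    unfolding col_relation_def by (rule order_trans[OF keys_diff Un_mono[OF order_refl keys_sum]])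
  then show ?thesis using assms
    by (fastforce simp: of_bool_def zero_free_word_def split: if_splits)
qed

lemma unitary_ideal_generators:
  "unitary_ideal g = genideal (free_algebra g)
     ({row_relation g i k | i k. i < g \<and> k < g} \<union> {col_relation g i k | i k. i < g \<and> k < g})"
  unfolding unitary_ideal_def unitary_relations_entries ..

lemma generators_carrier:
  "{row_relation g i k | i k. i < g \<and> k < g} \<union> {col_relation g i k | i k. i < g \<and> k < g}
     \<subseteq> carrier (free_algebra g)"
  using row_relation_carrier col_relation_carrier by blast

lemma unitary_ideal_ideal: "ideal (unitary_ideal g) (free_algebra g)"
  unfolding unitary_ideal_generators
  by (rule ring.genideal_ideal[OF ring_free_algebra generators_carrier])

lemma unitary_ideal_relations:
  assumes "i < g" "k < g"
  shows "row_relation g i k \<in> unitary_ideal g" "col_relation g i k \<in> unitary_ideal g"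
  using ring.genideal_self[OF ring_free_algebra generators_carrier] assms
  unfolding unitary_ideal_generators by blast+

lemma unitary_ideal_zero: "0 \<in> unitary_ideal g"
  using additive_subgroup.zero_closed[OF ideal.axioms(1)[OF unitary_ideal_ideal]] by simp

lemma unitary_ideal_add: "p \<in> unitary_ideal g \<Longrightarrow> q \<in> unitary_ideal g \<Longrightarrow> p + q \<in> unitary_ideal g"
  using additive_subgroup.a_closed[OF ideal.axioms(1)[OF unitary_ideal_ideal]] by fastforce

lemma unitary_ideal_mult_left:
  "p \<in> unitary_ideal g \<Longrightarrow> q \<in> carrier (free_algebra g) \<Longrightarrow> q * p \<in> unitary_ideal g"
  using ideal.I_l_closed[OF unitary_ideal_ideal] by fastforce

lemma unitary_ideal_mult_right:
  "p \<in> unitary_ideal g \<Longrightarrow> q \<in> carrier (free_algebra g) \<Longrightarrow> p * q \<in> unitary_ideal g"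
  using ideal.I_r_closed[OF unitary_ideal_ideal] by fastforce

text \<open>
  The polynomials that vanish at a fixed representation form a two-sided ideal, and the generators
  of the unitary ideal belong to it by the two equations of an inverse pair.
\<close>

lemma unitary_ideal_vanishes:
  assumes rep: "inverse_pair_rep g n E" and p: "p \<in> unitary_ideal g" and ab: "a < n" "b < n"
  shows "poly_entry n E p a b = 0"
proof -
  let ?F = "free_algebra g"
  let ?V = "{p \<in> carrier ?F. \<forall>a<n. \<forall>b<n. poly_entry n E p a b = 0}"
  interpret F: ring ?F by (rule ring_free_algebra)
  have inv: "\<ominus>\<^bsub>?F\<^esub> x = - x" if "x \<in> carrier ?F" for x
    using that by (intro F.minus_equality) (auto simp: Poly_Mapping.keys.rep_eq)
  have "ideal ?V ?F"
  proof (rule idealI)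
    show "ring ?F" by (rule ring_free_algebra)
    show "subgroup ?V (add_monoid ?F)"
    proof (rule subgroup.intro)
      show "?V \<subseteq> carrier (add_monoid ?F)" by auto
      show "\<one>\<^bsub>add_monoid ?F\<^esub> \<in> ?V" by (simp add: poly_entry_def)
      show "x \<otimes>\<^bsub>add_monoid ?F\<^esub> y \<in> ?V" if "x \<in> ?V" "y \<in> ?V" for x y
        using that F.a_closed[of x y] by (auto simp: poly_entry_add)
      show "inv\<^bsub>add_monoid ?F\<^esub> x \<in> ?V" if "x \<in> ?V" for x
      proof -
        have "inv\<^bsub>add_monoid ?F\<^esub> x = - x"
          using inv[of x] that by (simp add: a_inv_def)
        then show ?thesis using that by (simp add: poly_entry_uminus)
      qed
    qed
    show "x \<otimes>\<^bsub>?F\<^esub> y \<in> ?V" if "y \<in> ?V" "x \<in> carrier ?F" for x y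
      using that F.m_closed[of x y] by (auto simp: poly_entry_mult)
    show "y \<otimes>\<^bsub>?F\<^esub> x \<in> ?V" if "y \<in> ?V" "x \<in> carrier ?F" for x y
      using that F.m_closed[of y x] by (auto simp: poly_entry_mult)
  qed
  moreover have unit: "poly_entry n E 1 a b = of_bool (a = b)" for a b
    unfolding single_one[symmetric] poly_entry_single by (simp add: zero_free_word_def)
  have "poly_entry n E (row_relation g i k) a b = 0 \<and> poly_entry n E (col_relation g i k) a b = 0"
    if "i < g" "k < g" "a < n" "b < n" for i k a b
  proof -
    have two: "word_entry n E [l, m] a b = (\<Sum>c<n. E l a c * E m c b)" for l m
      using that by (simp add: sum_distrib_left of_bool_def if_distrib cong: if_cong)
    show ?thesis
      using rep that unfolding inverse_pair_rep_def
      by (auto simp del: word_entry.simps simp: row_relation_def col_relation_def poly_entry_diff poly_entry_sum two unit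
          of_bool_def)
  qed
  then have "\<forall>a<n. \<forall>b<n. poly_entry n E r a b = 0"
    if "r \<in> {row_relation g i k | i k. i < g \<and> k < g} \<union> {col_relation g i k | i k. i < g \<and> k < g}" for r
    using that by blast
  then have "{row_relation g i k | i k. i < g \<and> k < g} \<union> {col_relation g i k | i k. i < g \<and> k < g} \<subseteq> ?V"
    using generators_carrier[of g] by (intro subsetI CollectI conjI) (erule (1) subsetD)
  ultimately have "unitary_ideal g \<subseteq> ?V"
    unfolding unitary_ideal_generators by (rule F.genideal_minimal)
  then show ?thesis using p ab by auto
qed

section \<open>Normal forms modulo the unitary ideal\<close>

fun plain :: "letter \<Rightarrow> bool" where
  "plain (Var i j) = True"
| "plain (VarT i j) = False"

text \<open>
  Row and column refer to the position in the block matrix in which the letter occurs, so the two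
  indices of \<open>VarT i j\<close> are exchanged. In all relations the column of a letter is matched with
  the row of the letter to its right.
\<close>

fun row_index :: "letter \<Rightarrow> nat" where
  "row_index (Var i j) = i"
| "row_index (VarT i j) = j"

fun col_index :: "letter \<Rightarrow> nat" where
  "col_index (Var i j) = j"
| "col_index (VarT i j) = i"

text \<open>
  Colliding pairs are the leading terms of the relations \<open>\<Sum>\<^sub>j X\<^sub>i\<^sub>j (X\<^sup>T)\<^sub>j\<^sub>k = \<delta>\<^sub>i\<^sub>k\<close> and
  \<open>\<Sum>\<^sub>j (X\<^sup>T)\<^sub>i\<^sub>j X\<^sub>j\<^sub>k = \<delta>\<^sub>i\<^sub>k\<close> when the summand with \<open>j = 0\<close> is singled out.
\<close>

definition collide :: "letter \<Rightarrow> letter \<Rightarrow> bool" where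
  "collide l m \<longleftrightarrow> plain l \<noteq> plain m \<and> col_index l = 0 \<and> row_index m = 0"

definition normal_words :: "nat \<Rightarrow> nat \<Rightarrow> letter free_word set" where
  "normal_words g d =
     {Word w | w. (\<forall>l\<in>set w. letter_ok g l) \<and> successively (\<lambda>l m. \<not> collide l m) w \<and> length w \<le> d}"

definition reducible :: "nat \<Rightarrow> nat \<Rightarrow> nc_poly \<Rightarrow> bool" where
  "reducible g d p \<longleftrightarrow> (\<exists>q. Poly_Mapping.keys q \<subseteq> normal_words g d \<and> p - q \<in> unitary_ideal g)"

lemma normal_words_mono: "d \<le> e \<Longrightarrow> normal_words g d \<subseteq> normal_words g e"
  by (auto simp: normal_words_def)

lemma reducible_zero: "reducible g d 0"
  unfolding reducible_def by (rule exI[of _ 0]) (simp add: unitary_ideal_zero)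

lemma reducible_add:
  assumes "reducible g d p" "reducible g d p'"
  shows "reducible g d (p + p')"
proof -
  obtain q q' where "Poly_Mapping.keys q \<subseteq> normal_words g d" "p - q \<in> unitary_ideal g"
      "Poly_Mapping.keys q' \<subseteq> normal_words g d" "p' - q' \<in> unitary_ideal g"
    using assms unfolding reducible_def by blast
  moreover from this have "(p + p') - (q + q') \<in> unitary_ideal g"
    using unitary_ideal_add[of "p - q" g "p' - q'"] by (simp add: algebra_simps)
  moreover have "Poly_Mapping.keys (q + q') \<subseteq> Poly_Mapping.keys q \<union> Poly_Mapping.keys q'"
    by (rule Poly_Mapping.keys_add)
  ultimately show ?thesis
    unfolding reducible_def by (intro exI[of _ "q + q'"]) auto
qed

lemma reducible_sum: "(\<And>x. x \<in> S \<Longrightarrow> reducible g d (f x)) \<Longrightarrow> reducible g d (sum f S)"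
  by (induction S rule: infinite_finite_induct) (auto intro: reducible_zero reducible_add)

lemma reducible_cong_ideal:
  assumes "reducible g d q" "p - q \<in> unitary_ideal g"
  shows "reducible g d p"
proof -
  obtain q' where q': "Poly_Mapping.keys q' \<subseteq> normal_words g d" "q - q' \<in> unitary_ideal g"
    using assms unfolding reducible_def by blast
  have "(p - q) + (q - q') \<in> unitary_ideal g"
    by (rule unitary_ideal_add) (fact assms q')+
  then show ?thesis unfolding reducible_def using q' by auto
qed

lemma reducible_mono: "d \<le> e \<Longrightarrow> reducible g d p \<Longrightarrow> reducible g e p"
  unfolding reducible_def using normal_words_mono by blast

lemma single_carrier:
  "(\<forall>l\<in>set w. letter_ok g l) \<Longrightarrow> Poly_Mapping.single (Word w) c \<in> carrier (free_algebra g)"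
  by simp

lemma reducible_single:
  "Word w \<in> normal_words g d \<Longrightarrow> reducible g d (Poly_Mapping.single (Word w) c)"
  unfolding reducible_def
  by (rule exI[of _ "Poly_Mapping.single (Word w) c"]) (simp add: unitary_ideal_zero)

lemma sum_split_zero: "0 < (g::nat) \<Longrightarrow> (\<Sum>j<g. f j) = f 0 + (\<Sum>j\<in>{1..<g}. f j :: 'a::comm_monoid_add)"
proof -
  assume "0 < g"
  then have "{..<g} = insert 0 {1..<g}" by auto
  then show ?thesis by simp
qed

text \<open>
  One rewriting step suffices when a letter is put in front of a normal word. If the new letter
  collides with the first letter of the word, the relation replaces the inner index 0 by nonzero
  indices, and the second letter keeps its type and its column, so that it still does not collide
  with what follows.
\<close>

lemma reducible_Cons:
  assumes "0 < g" and u: "Word u \<in> normal_words g d" and l: "letter_ok g l"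
  shows "reducible g (Suc d) (Poly_Mapping.single (Word (l # u)) c)"
proof (cases "\<exists>m u'. u = m # u' \<and> collide l m")
  case False
  then have "Word (l # u) \<in> normal_words g (Suc d)"
    using u l by (cases u) (auto simp: normal_words_def)
  then show ?thesis by (rule reducible_single)
next
  case True
  then obtain m u' where m: "u = m # u'" "collide l m" by blast
  from m u have u'0: "Word u' \<in> normal_words g d" and ok: "letter_ok g m" "\<forall>l\<in>set u'. letter_ok g l"
    by (auto simp: normal_words_def successively_Cons)
  then have u': "Word u' \<in> normal_words g (Suc d)"
    using normal_words_mono[of d "Suc d" g] by auto
  let ?s = "\<lambda>w c. Poly_Mapping.single (Word w) c :: nc_poly"
  have main: "reducible g (Suc d) (?s (l # m # u') c)"
    if L: "L 0 = l" "M 0 = m"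
      and rel: "of_bool e - (\<Sum>j<g. ?s [L j, M j] 1) \<in> unitary_ideal g"
      and N: "\<And>j. 1 \<le> j \<Longrightarrow> j < g \<Longrightarrow> Word (L j # M j # u') \<in> normal_words g (Suc d)" for L M e
  proof (rule reducible_cong_ideal)
    let ?q = "?s u' (of_bool e * c) + (\<Sum>j\<in>{1..<g}. ?s (L j # M j # u') (- c))"
    show "reducible g (Suc d) ?q"
      using u' N by (intro reducible_add reducible_sum reducible_single) auto
    have "(of_bool e - (\<Sum>j<g. ?s [L j, M j] 1)) * ?s u' (- c)
        = of_bool e * ?s u' (- c) + (\<Sum>j<g. ?s (L j # M j # u') c)"
      by (simp add: left_diff_distrib sum_distrib_right mult_single plus_free_word_def single_uminus sum_negf)
    also have "\<dots> = ?s (l # m # u') c - ?q"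
      using \<open>0 < g\<close> L by (simp add: sum_split_zero single_uminus sum_negf of_bool_def)
    finally show "?s (l # m # u') c - ?q \<in> unitary_ideal g"
      using unitary_ideal_mult_right[OF rel single_carrier[of u' g "- c"]] ok by simp
  qed
  show ?thesis
  proof (cases l)
    case (Var i j)
    with m(2) obtain k where k: "m = VarT k 0" "j = 0"
      by (cases m) (auto simp: collide_def)
    have "reducible g (Suc d) (?s (l # m # u') c)"
    proof (rule main[of "Var i" "VarT k" "i = k"])
      show "of_bool (i = k) - (\<Sum>j<g. ?s [Var i j, VarT k j] 1) \<in> unitary_ideal g"
        using unitary_ideal_relations(1)[of i g k] Var l k ok by (simp add: row_relation_def)
      show "Word (Var i j # VarT k j # u') \<in> normal_words g (Suc d)" if "1 \<le> j" "j < g" for j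
        using that u m Var k l by (auto simp: normal_words_def successively_Cons collide_def)
    qed (use Var k in auto)
    then show ?thesis using m by simp
  next
    case (VarT j i)
    then obtain k where k: "m = Var 0 k" "j = 0"
      using m(2) by (cases m) (auto simp: collide_def)
    have "reducible g (Suc d) (?s (l # m # u') c)"
    proof (rule main[of "\<lambda>j. VarT j i" "\<lambda>j. Var j k" "i = k"])
      show "of_bool (i = k) - (\<Sum>j<g. ?s [VarT j i, Var j k] 1) \<in> unitary_ideal g"
        using unitary_ideal_relations(2)[of i g k] VarT l k ok by (simp add: col_relation_def)
      show "Word (VarT j i # Var j k # u') \<in> normal_words g (Suc d)" if "1 \<le> j" "j < g" for j
        using that u m VarT k l by (auto simp: normal_words_def successively_Cons collide_def)
    qed (use VarT k in auto)
    then show ?thesis using m by simp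
  qed
qed

lemma reducible_word:
  assumes "0 < g" "\<forall>l\<in>set w. letter_ok g l"
  shows "reducible g (length w) (Poly_Mapping.single (Word w) c)"
  using assms(2)
proof (induction w arbitrary: c)
  case Nil
  then show ?case
    by (intro reducible_single) (simp add: normal_words_def)
next
  case (Cons l w)
  let ?l = "Poly_Mapping.single (Word [l]) (1::complex)"
  obtain q where q: "Poly_Mapping.keys q \<subseteq> normal_words g (length w)"
      "Poly_Mapping.single (Word w) c - q \<in> unitary_ideal g"
    using Cons.IH[of c] Cons.prems unfolding reducible_def by auto
  have "?l * (Poly_Mapping.single (Word w) c - q) \<in> unitary_ideal g"
    using q(2) Cons.prems by (intro unitary_ideal_mult_left single_carrier) auto
  then have *: "Poly_Mapping.single (Word (l # w)) c - ?l * q \<in> unitary_ideal g"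
    by (simp add: right_diff_distrib mult_single plus_free_word_def)
  have "?l * q = (\<Sum>u\<in>Poly_Mapping.keys q. Poly_Mapping.single (Word (l # letters u)) (Poly_Mapping.lookup q u))"
    by (subst sum_of_monomials[of q]) (simp add: sum_distrib_left mult_single plus_free_word_def)
  moreover have "reducible g (Suc (length w)) \<dots>"
    using q(1) Cons.prems \<open>0 < g\<close> by (intro reducible_sum reducible_Cons) auto
  ultimately show ?case
    using reducible_cong_ideal[OF _ *] by simp
qed

lemma reducible_degree:
  assumes "0 < g" "p \<in> carrier (free_algebra g)"
  shows "reducible g (nc_degree p) p"
proof -
  have len: "length (letters w) \<le> nc_degree p" if "w \<in> Poly_Mapping.keys p" for w
    unfolding nc_degree_def using that by (intro Max_ge) auto
  have "reducible g (nc_degree p) (\<Sum>w\<in>Poly_Mapping.keys p. Poly_Mapping.single w (Poly_Mapping.lookup p w))"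
  proof (intro reducible_sum)
    fix w assume w: "w \<in> Poly_Mapping.keys p"
    then have "reducible g (length (letters w)) (Poly_Mapping.single (Word (letters w)) (Poly_Mapping.lookup p w))"
      using assms by (intro reducible_word) auto
    then show "reducible g (nc_degree p) (Poly_Mapping.single w (Poly_Mapping.lookup p w))"
      using len[OF w] by (auto intro: reducible_mono)
  qed
  then show ?thesis by (simp flip: sum_of_monomials)
qed

section \<open>Unitary matrices are Zariski dense among invertible ones\<close>

lemma mat_adjoint_carrier:
  fixes A :: "complex mat"
  shows "A \<in> carrier_mat r c \<Longrightarrow> mat_adjoint A \<in> carrier_mat c r"
  by (auto simp: mat_adjoint_def mat_of_rows_def)

lemma mat_adjoint_mult:
  fixes A B :: "complex mat"
  assumes "A \<in> carrier_mat m m" "B \<in> carrier_mat m m"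
  shows "mat_adjoint (A * B) = mat_adjoint B * mat_adjoint A"
proof -
  have dims: "dim_row (mat_adjoint A) = m" "dim_col (mat_adjoint A) = m"
      "dim_row (mat_adjoint B) = m" "dim_col (mat_adjoint B) = m"
      "dim_row (mat_adjoint (A * B)) = m" "dim_col (mat_adjoint (A * B)) = m"
    using mat_adjoint_carrier[OF assms(1)] mat_adjoint_carrier[OF assms(2)]
      mat_adjoint_carrier[OF mult_carrier_mat[OF assms]] by (simp_all only: carrier_matD)
  show ?thesis
  proof (rule eq_matI)
    fix i j assume "i < dim_row (mat_adjoint B * mat_adjoint A)" "j < dim_col (mat_adjoint B * mat_adjoint A)"
    then have ij: "i < m" "j < m"
      using dims by simp_all
    then show "mat_adjoint (A * B) $$ (i, j) = (mat_adjoint B * mat_adjoint A) $$ (i, j)"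
      using assms dims by (simp add: mat_adjoint_index scalar_prod_def mult.commute cnj_sum)
  qed (simp_all add: dims)
qed

lemma mat_adjoint_one: "mat_adjoint (1\<^sub>m m :: complex mat) = 1\<^sub>m m"
proof (rule eq_matI)
  show "mat_adjoint (1\<^sub>m m :: complex mat) $$ (i, j) = 1\<^sub>m m $$ (i, j)" if "i < dim_row (1\<^sub>m m)" "j < dim_col (1\<^sub>m m)" for i j
    using that by (auto simp: mat_adjoint_index)
qed (use mat_adjoint_carrier[OF one_carrier_mat[of m]] in \<open>auto dest: carrier_matD\<close>)

lemma smult_smult_mat: "a \<cdot>\<^sub>m (b \<cdot>\<^sub>m A) = (a * b :: 'a::comm_ring_1) \<cdot>\<^sub>m A"
  by (rule eq_matI) (auto simp: mult.assoc)

lemma one_smult_mat: "(1 :: 'a::comm_ring_1) \<cdot>\<^sub>m A = A"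
  by (rule eq_matI) auto

lemma inverse_mat_unique:
  fixes A :: "'a::field mat"
  assumes "A \<in> carrier_mat m m" "B \<in> carrier_mat m m" "C \<in> carrier_mat m m"
    and "B * A = 1\<^sub>m m" "A * C = 1\<^sub>m m"
  shows "B = C"
proof -
  have "B = B * (A * C)" using assms by simp
  also have "\<dots> = (B * A) * C" using assms by (intro assoc_mult_mat[symmetric])
  finally show ?thesis using assms by simp
qed

text \<open>
  For \<open>Y = W\<^sup>-\<^sup>1 - 1\<close> the inverse is \<open>Y\<^sup>-\<^sup>1 = (1 - W)\<^sup>-\<^sup>1 - 1\<close>. This is how the inverse of a Cayley transform
  appears in the coordinate \<open>W = (Y + 1)\<^sup>-\<^sup>1\<close>: with \<open>V = 1 - W\<close> it follows from
  \<open>V\<^sup>-\<^sup>1 W\<^sup>-\<^sup>1 = V\<^sup>-\<^sup>1 (W + V) W\<^sup>-\<^sup>1 = V\<^sup>-\<^sup>1 + W\<^sup>-\<^sup>1\<close>.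
\<close>

lemma complementary_inverses:
  fixes W :: "'a::field mat"
  assumes c: "W \<in> carrier_mat m m" "V \<in> carrier_mat m m" "P \<in> carrier_mat m m" "R \<in> carrier_mat m m"
    and sum: "W + V = 1\<^sub>m m" and inv: "W * P = 1\<^sub>m m" "R * V = 1\<^sub>m m"
  shows "(R - 1\<^sub>m m) * (P - 1\<^sub>m m) = 1\<^sub>m m"
proof -
  have "R * P = R * ((W + V) * P)" using c sum by simp
  also have "\<dots> = R * (W * P + V * P)" using c by (simp add: add_mult_distrib_mat)
  also have "\<dots> = R * (W * P) + R * (V * P)" using c by (intro mult_add_distrib_mat) auto
  also have "R * (V * P) = (R * V) * P" using c by simp
  finally have RP: "R * P = R + P" using c inv by simp
  have "(R - 1\<^sub>m m) * (P - 1\<^sub>m m) = R * (P - 1\<^sub>m m) - 1\<^sub>m m * (P - 1\<^sub>m m)"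
    using c by (intro minus_mult_distrib_mat) auto
  also have "R * (P - 1\<^sub>m m) = R * P - R * 1\<^sub>m m"
    using c by (intro mult_minus_distrib_mat) auto
  also have "1\<^sub>m m * (P - 1\<^sub>m m) = P - 1\<^sub>m m"
    using c by (intro left_mult_one_mat) auto
  also have "R * P - R * 1\<^sub>m m = R + P - R"
    unfolding RP right_mult_one_mat[OF c(4)] ..
  also have "R + P - R - (P - 1\<^sub>m m) = 1\<^sub>m m"
    using c by (intro eq_matI) auto
  finally show ?thesis .
qed

lemma unit_complex_avoiding_finite:
  assumes "finite S"
  obtains k :: complex where "cmod k = 1" "k \<notin> S"
proof -
  let ?n = "Suc (card S)"
  have "\<not> {z::complex. z ^ ?n = 1} \<subseteq> S"
  proof
    assume "{z::complex. z ^ ?n = 1} \<subseteq> S"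
    then have "card {z::complex. z ^ ?n = 1} \<le> card S"
      by (rule card_mono[OF assms])
    then show False
      unfolding card_roots_unity_eq[OF zero_less_Suc] by simp
  qed
  then obtain k where k: "k ^ ?n = 1" "k \<notin> S" by blast
  have "cmod k ^ ?n = 1" unfolding norm_power[symmetric] k(1) by simp
  then have "cmod k = 1"
    using power_eq_imp_eq_base[of "cmod k" ?n 1] by simp
  then show ?thesis using that k by blast
qed

text \<open>
  The Cayley transform needs \<open>-1\<close> not to be an eigenvalue. A scalar of modulus 1 moves the finitely
  many eigenvalues away without disturbing unitarity.
\<close>

lemma det_shift_nonzero:
  fixes X :: "complex mat"
  assumes "X \<in> carrier_mat m m"
  obtains c where "cmod c = 1" "det (X + c \<cdot>\<^sub>m 1\<^sub>m m) \<noteq> 0"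
proof -
  have "char_poly X \<noteq> 0" using degree_monic_char_poly[OF assms] by auto
  then have "finite {k. poly (char_poly X) k = 0}" by (rule poly_roots_finite)
  then obtain k where k: "cmod k = 1" "poly (char_poly X) k \<noteq> 0"
    using unit_complex_avoiding_finite by blast
  then have "det (char_matrix X k) \<noteq> 0"
    using eigenvalue_det[OF assms] eigenvalue_root_char_poly[OF assms] by blast
  then show ?thesis
    using that[of "- k"] k assms by (simp add: char_matrix_def)
qed

lemma inverse_of_det_nonzero:
  fixes A :: "'a::field mat"
  assumes A: "A \<in> carrier_mat m m" and "det A \<noteq> 0"
  defines "B \<equiv> (1 / det A) \<cdot>\<^sub>m adj_mat A"
  shows "B \<in> carrier_mat m m" "A * B = 1\<^sub>m m" "B * A = 1\<^sub>m m"
proof -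
  note adj = adj_mat[OF A]
  show "B \<in> carrier_mat m m" using adj by (simp add: B_def)
  show "A * B = 1\<^sub>m m" using adj A assms(2)
    by (simp add: B_def mult_smult_distrib[OF A adj(1)] smult_smult_mat one_smult_mat)
  show "B * A = 1\<^sub>m m" using adj A assms(2)
    by (simp add: B_def mult_smult_assoc_mat[OF adj(1) A] smult_smult_mat one_smult_mat)
qed

lemma det_nonzero_of_inverse:
  fixes A :: "'a::field mat"
  assumes "A \<in> carrier_mat m m" "B \<in> carrier_mat m m" "A * B = 1\<^sub>m m"
  shows "det A \<noteq> 0"
  using det_mult[OF assms(1,2)] assms(3) by auto

text \<open>
  An inverse pair lies on a rational curve \<open>t \<mapsto> (PX(t)/q(t), PZ(t)/q(t))\<close> that runs through pairs
  \<open>(U, U\<^sup>*)\<close> with \<open>U\<close> unitary at all real \<open>t\<close> outside the poles and through the given pair at \<open>t = \<i>\<close>.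
  In the coordinate \<open>W = (Y + 1)\<^sup>-\<^sup>1\<close> of the rescaled matrix \<open>Y\<close>, unitarity of \<open>Y\<close> becomes the
  real-linear condition \<open>W + W\<^sup>* = 1\<close>, and the curve is a line.
\<close>

lemma unitary_path:
  fixes X Z :: "complex mat"
  assumes X: "X \<in> carrier_mat m m" and Z: "Z \<in> carrier_mat m m" and XZ: "X * Z = 1\<^sub>m m" "Z * X = 1\<^sub>m m"
  obtains q :: "complex poly" and PX PZ :: "complex poly mat" where
    "poly q \<i> \<noteq> 0"
    "\<And>r s. r < m \<Longrightarrow> s < m \<Longrightarrow> poly (PX $$ (r, s)) \<i> = poly q \<i> * X $$ (r, s)"
    "\<And>r s. r < m \<Longrightarrow> s < m \<Longrightarrow> poly (PZ $$ (r, s)) \<i> = poly q \<i> * Z $$ (r, s)"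
    "\<And>t::real. poly q (of_real t) \<noteq> 0 \<Longrightarrow> \<exists>U\<in>carrier_mat m m. mat_adjoint U * U = 1\<^sub>m m \<and>
       (\<forall>r<m. \<forall>s<m. poly (PX $$ (r, s)) (of_real t) = poly q (of_real t) * U $$ (r, s) \<and>
          poly (PZ $$ (r, s)) (of_real t) = poly q (of_real t) * mat_adjoint U $$ (r, s))"
proof -
  obtain c where c: "cmod c = 1" "det (X + c \<cdot>\<^sub>m 1\<^sub>m m) \<noteq> 0"
    using det_shift_nonzero[OF X] .
  have cc: "c * cnj c = 1" "cnj c * c = 1"
    using c(1) by (simp_all add: complex_norm_square[symmetric] mult.commute)
  define T where "T = X + c \<cdot>\<^sub>m 1\<^sub>m m"
  have T: "T \<in> carrier_mat m m" using X by (simp add: T_def)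
  obtain Ti where Ti: "Ti \<in> carrier_mat m m" "T * Ti = 1\<^sub>m m" "Ti * T = 1\<^sub>m m"
    using inverse_of_det_nonzero[OF T] c(2) T_def by blast
  define W where "W = c \<cdot>\<^sub>m Ti"
  define Y where "Y = cnj c \<cdot>\<^sub>m X"
  define Yi where "Yi = c \<cdot>\<^sub>m Z"
  have W: "W \<in> carrier_mat m m" and Y: "Y \<in> carrier_mat m m" and Yi: "Yi \<in> carrier_mat m m"
    using Ti X Z by (simp_all add: W_def Y_def Yi_def)
  have YT: "Y + 1\<^sub>m m = cnj c \<cdot>\<^sub>m T"
    using X cc by (intro eq_matI) (auto simp: Y_def T_def algebra_simps)
  have YiY: "Yi * Y = 1\<^sub>m m"
    using X Z XZ cc by (simp add: Y_def Yi_def mult_smult_assoc_mat[of _ m m _ m] mult_smult_distrib[of _ m m _ m] smult_smult_mat one_smult_mat)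
  have YW: "(Y + 1\<^sub>m m) * W = 1\<^sub>m m" "W * (Y + 1\<^sub>m m) = 1\<^sub>m m"
    unfolding YT W_def using Ti T cc
    by (simp_all add: mult_smult_assoc_mat[of _ m m _ m] mult_smult_distrib[of _ m m _ m] smult_smult_mat one_smult_mat)
  define V where "V = 1\<^sub>m m - W"
  have V: "V \<in> carrier_mat m m" unfolding V_def using W by (rule minus_carrier_mat)
  have "Y * W + W = (Y + 1\<^sub>m m) * W"
    using Y W by (simp add: add_mult_distrib_mat[of _ m m _ _ m])
  also have "\<dots> = 1\<^sub>m m" by (rule YW)
  finally have YWW: "Y * W + W = 1\<^sub>m m" .
  have V_eq: "V = Y * W"
    unfolding V_def YWW[symmetric] using Y W by (intro eq_matI) auto
  have "(Yi + 1\<^sub>m m) * (Y * W) = Yi * (Y * W) + 1\<^sub>m m * (Y * W)"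
    using Yi Y W by (intro add_mult_distrib_mat) auto
  also have "Yi * (Y * W) = (Yi * Y) * W"
    using Yi Y W by (intro assoc_mult_mat[symmetric])
  finally have YiV: "(Yi + 1\<^sub>m m) * V = 1\<^sub>m m"
    using YiY YWW Y W unfolding V_eq by (simp add: comm_add_mat[of W m m])
  have Yi1: "Yi + 1\<^sub>m m \<in> carrier_mat m m" and Y1: "Y + 1\<^sub>m m \<in> carrier_mat m m" using Yi Y by auto
  have VYi: "V * (Yi + 1\<^sub>m m) = 1\<^sub>m m"
    using mat_mult_left_right_inverse[OF Yi1 V YiV] .
  \<comment> \<open>The line \<open>\<alpha> + t \<beta>\<close> passes through \<open>W\<close> at \<open>t = \<i>\<close>, where \<open>\<alpha> - 1/2\<close> is the skew-Hermitian
    part of \<open>W - 1/2\<close> and \<open>\<i> \<beta>\<close> its Hermitian part, so that \<open>\<beta>\<close> is skew-Hermitian too.\<close>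
  define \<alpha> where "\<alpha> r s = of_bool (r = s) / 2 + (W $$ (r, s) - cnj (W $$ (s, r))) / 2" for r s
  define \<beta> where "\<beta> r s = - \<i> * (W $$ (r, s) + cnj (W $$ (s, r)) - of_bool (r = s)) / 2" for r s
  have \<alpha>\<beta>: "\<alpha> r s + \<i> * \<beta> r s = W $$ (r, s)" for r s
    by (simp add: \<alpha>_def \<beta>_def field_simps)
  have skew: "cnj (\<alpha> s r) = of_bool (r = s) - \<alpha> r s" "cnj (\<beta> s r) = - \<beta> r s" for r s
    by (auto simp: \<alpha>_def \<beta>_def field_simps)
  define PW where "PW = mat m m (\<lambda>(r, s). [:\<alpha> r s, \<beta> r s:])"
  define PV where "PV = mat m m (\<lambda>(r, s). [:of_bool (r = s):] - [:\<alpha> r s, \<beta> r s:])"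
  have PW: "PW \<in> carrier_mat m m" and PV: "PV \<in> carrier_mat m m"
    by (simp_all add: PW_def PV_def)
  define q where "q = det PW * det PV"
  define PX where "PX = mat m m (\<lambda>(r, s). [:c:] * (det PV * adj_mat PW $$ (r, s) - of_bool (r = s) * q))"
  define PZ where "PZ = mat m m (\<lambda>(r, s). [:cnj c:] * (det PW * adj_mat PV $$ (r, s) - of_bool (r = s) * q))"
  define ev where "ev t = map_mat (\<lambda>p. poly p t)" for t :: complex
  have hom: "comm_ring_hom (\<lambda>p. poly p t)" for t :: complex
    by unfold_locales auto
  define Pi where "Pi t = (1 / poly (det PW) t) \<cdot>\<^sub>m ev t (adj_mat PW)" for t
  define Ri where "Ri t = (1 / poly (det PV) t) \<cdot>\<^sub>m ev t (adj_mat PV)" for t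
  have carr: "ev t PW \<in> carrier_mat m m" "ev t PV \<in> carrier_mat m m" "Pi t \<in> carrier_mat m m" "Ri t \<in> carrier_mat m m" for t
    using PW PV adj_mat(1)[OF PW] adj_mat(1)[OF PV] by (simp_all add: ev_def Pi_def Ri_def)
  have ev_det: "det (ev t PW) = poly (det PW) t" "det (ev t PV) = poly (det PV) t" for t
    unfolding ev_def by (rule comm_ring_hom.hom_det[OF hom])+
  have inv: "A' * B' = 1\<^sub>m m \<and> B' * A' = 1\<^sub>m m"
    if P: "P \<in> carrier_mat m m" and A': "A' = ev t P" and B': "B' = (1 / poly (det P) t) \<cdot>\<^sub>m ev t (adj_mat P)"
      and nz: "poly (det P) t \<noteq> 0" for P A' B' t
  proof -
    have "ev t P * ev t (adj_mat P) = ev t (P * adj_mat P)" "ev t (adj_mat P) * ev t P = ev t (adj_mat P * P)"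
      unfolding ev_def using P adj_mat(1)[OF P]
      by (simp_all add: semiring_hom.mat_hom_mult[OF comm_ring_hom.axioms(1)[OF hom, THEN ring_hom.axioms(1)]])
    then have eq: "ev t P * ev t (adj_mat P) = poly (det P) t \<cdot>\<^sub>m 1\<^sub>m m" "ev t (adj_mat P) * ev t P = poly (det P) t \<cdot>\<^sub>m 1\<^sub>m m"
      unfolding adj_mat(2,3)[OF P] by (auto simp: ev_def intro!: eq_matI)
    have "ev t P \<in> carrier_mat m m" "ev t (adj_mat P) \<in> carrier_mat m m"
      using P adj_mat(1)[OF P] by (simp_all add: ev_def)
    then show ?thesis
      unfolding A' B' using eq nz
      by (simp add: mult_smult_assoc_mat[of _ m m _ m] mult_smult_distrib[of _ m m _ m] smult_smult_mat one_smult_mat)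
  qed
  have PX_eq: "poly (PX $$ (r, s)) t = poly q t * (c \<cdot>\<^sub>m (Pi t - 1\<^sub>m m)) $$ (r, s)"
    and PZ_eq: "poly (PZ $$ (r, s)) t = poly q t * (cnj c \<cdot>\<^sub>m (Ri t - 1\<^sub>m m)) $$ (r, s)"
    if "r < m" "s < m" "poly q t \<noteq> 0" for r s t
    using that adj_mat(1)[OF PW] adj_mat(1)[OF PV]
    by (auto simp: PX_def PZ_def Pi_def Ri_def ev_def q_def of_bool_def field_simps)
  \<comment> \<open>By uniqueness of inverses the curve meets the given pair at \<open>t = \<i>\<close>; in particular \<open>\<i>\<close>
    is not a pole.\<close>
  have evW: "ev \<i> PW = W" "ev \<i> PV = V"
    using W \<alpha>\<beta> by (auto simp: ev_def PW_def PV_def V_def algebra_simps intro!: eq_matI)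
  have q0: "poly (det PW) \<i> \<noteq> 0" "poly (det PV) \<i> \<noteq> 0"
    using ev_det[of \<i>] det_nonzero_of_inverse[OF W Y1 YW(2)] det_nonzero_of_inverse[OF V Yi1 VYi]
    by (simp_all add: evW)
  have Pii: "Pi \<i> = Y + 1\<^sub>m m"
    using inverse_mat_unique[OF W carr(3) Y1 _ YW(2)] inv[OF PW refl refl q0(1)] by (simp add: evW Pi_def)
  have Rii: "Ri \<i> = Yi + 1\<^sub>m m"
    using inverse_mat_unique[OF V carr(4) Yi1 _ VYi] inv[OF PV refl refl q0(2)] by (simp add: evW Ri_def)
  show ?thesis
  proof (rule that[of q PX PZ])
    show qi: "poly q \<i> \<noteq> 0" using q0 by (simp add: q_def)
    show "poly (PX $$ (r, s)) \<i> = poly q \<i> * X $$ (r, s)" if "r < m" "s < m" for r s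
      using that qi X cc by (simp add: PX_eq Pii Y_def mult.assoc[symmetric])
    show "poly (PZ $$ (r, s)) \<i> = poly q \<i> * Z $$ (r, s)" if "r < m" "s < m" for r s
      using that qi Z cc by (simp add: PZ_eq Rii Yi_def mult.assoc[symmetric])
    fix t :: real assume qt: "poly q (of_real t) \<noteq> 0"
    let ?t = "of_real t :: complex"
    define U where "U = c \<cdot>\<^sub>m (Pi ?t - 1\<^sub>m m)"
    have U: "U \<in> carrier_mat m m" unfolding U_def by (intro smult_carrier_mat minus_carrier_mat one_carrier_mat)
    have nz: "poly (det PW) ?t \<noteq> 0" "poly (det PV) ?t \<noteq> 0"
      using qt by (auto simp: q_def)
    have WPi: "ev ?t PW * Pi ?t = 1\<^sub>m m"
      using inv[OF PW refl refl nz(1)] by (simp add: Pi_def)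
    have RiV: "Ri ?t * ev ?t PV = 1\<^sub>m m" "ev ?t PV * Ri ?t = 1\<^sub>m m"
      using inv[OF PV refl refl nz(2)] by (simp_all add: Ri_def)
    \<comment> \<open>On the real axis \<open>W(t)\<^sup>* = 1 - W(t)\<close>, hence the adjoint of \<open>W(t)\<^sup>-\<^sup>1\<close> is \<open>(1 - W(t))\<^sup>-\<^sup>1\<close>.\<close>
    have adjW: "mat_adjoint (ev ?t PW) = ev ?t PV"
    proof (rule eq_matI)
      show "mat_adjoint (ev ?t PW) $$ (r, s) = ev ?t PV $$ (r, s)" if "r < dim_row (ev ?t PV)" "s < dim_col (ev ?t PV)" for r s
        using that skew[of s r] by (simp add: mat_adjoint_index ev_def PW_def PV_def)
    qed (use carr(2)[of ?t] mat_adjoint_carrier[OF carr(1)[of ?t]] in \<open>simp_all only: carrier_matD\<close>)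
    have "mat_adjoint (Pi ?t) * ev ?t PV = 1\<^sub>m m"
      using mat_adjoint_mult[OF carr(1,3), of ?t ?t] WPi by (simp add: adjW mat_adjoint_one)
    then have adjPi: "mat_adjoint (Pi ?t) = Ri ?t"
      using inverse_mat_unique[OF carr(2) mat_adjoint_carrier[OF carr(3)] carr(4)] RiV by blast
    have adjU: "mat_adjoint U = cnj c \<cdot>\<^sub>m (Ri ?t - 1\<^sub>m m)"
    proof (rule eq_matI)
      fix r s assume "r < dim_row (cnj c \<cdot>\<^sub>m (Ri ?t - 1\<^sub>m m))" "s < dim_col (cnj c \<cdot>\<^sub>m (Ri ?t - 1\<^sub>m m))"
      then have rs: "r < m" "s < m" by auto
      have "Ri ?t $$ (r, s) = cnj (Pi ?t $$ (s, r))"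
        using rs carr(3)[of ?t] by (simp add: mat_adjoint_index flip: adjPi)
      then show "mat_adjoint U $$ (r, s) = (cnj c \<cdot>\<^sub>m (Ri ?t - 1\<^sub>m m)) $$ (r, s)"
        using rs U carr[of ?t] by (auto simp: mat_adjoint_index U_def)
    qed (use carr(4)[of ?t] mat_adjoint_carrier[OF U] in \<open>auto dest: carrier_matD\<close>)
    have "ev ?t PW + ev ?t PV = 1\<^sub>m m"
      by (rule eq_matI) (auto simp: ev_def PW_def PV_def)
    then have "(Ri ?t - 1\<^sub>m m) * (Pi ?t - 1\<^sub>m m) = 1\<^sub>m m"
      using carr WPi RiV(1) by (intro complementary_inverses)
    then have "mat_adjoint U * U = 1\<^sub>m m"
      unfolding adjU unfolding U_def using carr cc
      by (simp add: mult_smult_assoc_mat[of _ m m _ m] mult_smult_distrib[of _ m m _ m] smult_smult_mat one_smult_mat minus_carrier_mat)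
    then show "\<exists>U\<in>carrier_mat m m. mat_adjoint U * U = 1\<^sub>m m \<and>
       (\<forall>r<m. \<forall>s<m. poly (PX $$ (r, s)) ?t = poly q ?t * U $$ (r, s) \<and>
          poly (PZ $$ (r, s)) ?t = poly q ?t * mat_adjoint U $$ (r, s))"
      using U PX_eq[OF _ _ qt] PZ_eq[OF _ _ qt] by (intro bexI[of _ U]) (auto simp: adjU simp flip: U_def)
  qed
qed

section \<open>From unitary matrices to arbitrary inverse pairs\<close>

lemma word_entry_cong:
  assumes "\<And>l a c. l \<in> set w \<Longrightarrow> a < n \<Longrightarrow> c < n \<Longrightarrow> E l a c = E' l a c" "a < n"
  shows "word_entry n E w a b = word_entry n E' w a b"
  using assms by (induction w arbitrary: a) (auto intro!: sum.cong)

lemma word_entry_scale: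
  "word_entry n (\<lambda>l a c. k * E l a c) w a b = k ^ length w * word_entry n E w a b"
  by (induction w arbitrary: a) (auto simp: sum_distrib_left mult_ac)

lemma poly_word_entry:
  "poly (word_entry n E w a b) t = word_entry n (\<lambda>l a c. poly (E l a c) t) w a b"
  by (induction w arbitrary: a) (auto simp: poly_sum)

definition mat_rep :: "nat \<Rightarrow> 'a mat \<Rightarrow> 'a mat \<Rightarrow> letter \<Rightarrow> nat \<Rightarrow> nat \<Rightarrow> 'a" where
  "mat_rep n X Z l a c =
     (case l of Var i j \<Rightarrow> X $$ (i * n + a, j * n + c) | VarT i j \<Rightarrow> Z $$ (j * n + a, i * n + c))"

lemma flat_index_less:
  assumes "i < g" "a < (n::nat)"
  shows "i * n + a < g * n"
proof -
  have "i * n + a < Suc i * n" using assms by simp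
  also have "\<dots> \<le> g * n" using assms by (intro mult_le_mono1) simp
  finally show ?thesis .
qed

lemma sum_flat: "(\<Sum>r<g * n. f r) = (\<Sum>j<g. \<Sum>c<n. f (j * n + c :: nat))"
proof -
  have "(\<Sum>r<g * n. f r) = (\<Sum>j<g. sum f {j * n..<j * n + n})"
    by (rule sum.nat_group[symmetric])
  also have "\<dots> = (\<Sum>j<g. \<Sum>c<n. f (j * n + c))"
  proof (rule sum.cong[OF refl])
    fix j
    show "sum f {j * n..<j * n + n} = (\<Sum>c<n. f (j * n + c))"
      by (rule sum.reindex_bij_witness[where i = "\<lambda>c. j * n + c" and j = "\<lambda>r. r - j * n"]) auto
  qed
  finally show ?thesis .
qed

lemma nc_eval_blocks:
  fixes U :: "complex mat"
  assumes U: "U \<in> carrier_mat (g * n) (g * n)" and p: "p \<in> carrier (free_algebra g)" and ab: "a < n" "b < n"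
  defines "A \<equiv> \<lambda>i j. mat n n (\<lambda>(a, c). U $$ (i * n + a, j * n + c))"
  shows "block_mat g n A = U"
    and "nc_eval n A p $$ (a, b) = poly_entry n (mat_rep n U (mat_adjoint U)) p a b"
proof -
  have div: "r div n < g" "r mod n < n" if "r < g * n" for r
    using that by (auto simp: less_mult_imp_div_less intro!: mod_less_divisor intro: Nat.gr0I)
  show "block_mat g n A = U"
    using U div by (intro eq_matI) (auto simp: block_mat_def A_def)
  have letter: "eval_letter A l \<in> carrier_mat n n \<and> (\<forall>a<n. \<forall>c<n. eval_letter A l $$ (a, c) = mat_rep n U (mat_adjoint U) l a c)"
    if "letter_ok g l" for l
    using that U mat_adjoint_carrier[of _ n n]
    by (cases l) (auto simp: A_def mat_rep_def mat_adjoint_index flat_index_less)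
  have word: "eval_word n A (Word w) \<in> carrier_mat n n \<and>
      (\<forall>a<n. eval_word n A (Word w) $$ (a, b) = word_entry n (mat_rep n U (mat_adjoint U)) w a b)"
    if "\<forall>l\<in>set w. letter_ok g l" for w
    using that
  proof (induction w)
    case Nil
    then show ?case using ab by (simp add: eval_word_def)
  next
    case (Cons l w)
    have eq: "eval_word n A (Word (l # w)) = eval_letter A l * eval_word n A (Word w)"
      by (simp add: eval_word_def)
    have w: "eval_word n A (Word w) \<in> carrier_mat n n"
        "\<And>a. a < n \<Longrightarrow> eval_word n A (Word w) $$ (a, b) = word_entry n (mat_rep n U (mat_adjoint U)) w a b"
      using Cons by auto
    have l: "eval_letter A l \<in> carrier_mat n n"
        "\<And>a c. a < n \<Longrightarrow> c < n \<Longrightarrow> eval_letter A l $$ (a, c) = mat_rep n U (mat_adjoint U) l a c"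
      using letter[of l] Cons.prems by auto
    have "(eval_letter A l * eval_word n A (Word w)) $$ (a, b) = word_entry n (mat_rep n U (mat_adjoint U)) (l # w) a b"
      if "a < n" for a
      using that l w ab by (auto simp: scalar_prod_def lessThan_atLeast0 intro!: sum.cong)
    then show ?case
      unfolding eq using mult_carrier_mat[OF l(1) w(1)] by blast
  qed
  have "eval_word n A w $$ (a, b) = word_entry n (mat_rep n U (mat_adjoint U)) (letters w) a b"
    if "w \<in> Poly_Mapping.keys p" for w
    using word[of "letters w"] that p ab by auto
  then show "nc_eval n A p $$ (a, b) = poly_entry n (mat_rep n U (mat_adjoint U)) p a b"
    using ab by (simp add: nc_eval_def poly_entry_def)
qed

text \<open>
  Along the curve of \<open>unitary_path\<close> the entry of \<open>p\<close> is, up to the power \<open>q\<^sup>u\<close> of the denominator, a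
  polynomial \<open>F\<close> in \<open>t\<close>. It vanishes at all but finitely many real \<open>t\<close>, hence also at \<open>t = \<i>\<close>.
\<close>

lemma vanishes_on_inverse_pairs:
  assumes van: "\<forall>A. partitioned_unitary g n A \<longrightarrow> nc_eval n A p = 0\<^sub>m n n"
    and p: "p \<in> carrier (free_algebra g)"
    and rep: "inverse_pair_rep g n E" and ab: "a < n" "b < n"
  shows "poly_entry n E p a b = 0"
proof -
  let ?m = "g * n" and ?u = "nc_degree p"
  define X where "X = mat ?m ?m (\<lambda>(r, s). E (Var (r div n) (s div n)) (r mod n) (s mod n))"
  define Z where "Z = mat ?m ?m (\<lambda>(r, s). E (VarT (s div n) (r div n)) (r mod n) (s mod n))"
  have X: "X \<in> carrier_mat ?m ?m" and Z: "Z \<in> carrier_mat ?m ?m"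
    by (simp_all add: X_def Z_def)
  have div: "r div n < g" "r mod n < n" if "r < g * n" for r
    using that ab by (auto simp: less_mult_imp_div_less intro!: mod_less_divisor)
  have flat: "r = s \<longleftrightarrow> r div n = s div n \<and> r mod n = s mod n" for r s
    by (metis div_mult_mod_eq)
  have XZ: "X * Z = 1\<^sub>m ?m"
  proof (rule eq_matI)
    fix r s assume "r < dim_row (1\<^sub>m ?m :: complex mat)" "s < dim_col (1\<^sub>m ?m :: complex mat)"
    then have rs: "r < ?m" "s < ?m" by auto
    have "(X * Z) $$ (r, s) = (\<Sum>k<?m. X $$ (r, k) * Z $$ (k, s))"
      using rs X Z by (simp add: scalar_prod_def lessThan_atLeast0)
    also have "\<dots> = (\<Sum>j<g. \<Sum>c<n. E (Var (r div n) j) (r mod n) c * E (VarT (s div n) j) c (s mod n))"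
      unfolding sum_flat using rs by (intro sum.cong refl) (simp add: X_def Z_def flat_index_less)
    also have "\<dots> = of_bool (r = s)"
      using rep div[OF rs(1)] div[OF rs(2)] unfolding inverse_pair_rep_def flat[of r s] by blast
    finally show "(X * Z) $$ (r, s) = 1\<^sub>m ?m $$ (r, s)" using rs by simp
  qed (use X Z in auto)
  have ZX: "Z * X = 1\<^sub>m ?m"
    by (rule mat_mult_left_right_inverse[OF X Z XZ])
  obtain q PX PZ where q: "poly q \<i> \<noteq> 0"
    and PX: "\<And>r s. r < ?m \<Longrightarrow> s < ?m \<Longrightarrow> poly (PX $$ (r, s)) \<i> = poly q \<i> * X $$ (r, s)"
    and PZ: "\<And>r s. r < ?m \<Longrightarrow> s < ?m \<Longrightarrow> poly (PZ $$ (r, s)) \<i> = poly q \<i> * Z $$ (r, s)"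
    and unitary: "\<And>t::real. poly q (of_real t) \<noteq> 0 \<Longrightarrow> \<exists>U\<in>carrier_mat ?m ?m. mat_adjoint U * U = 1\<^sub>m ?m \<and>
       (\<forall>r<?m. \<forall>s<?m. poly (PX $$ (r, s)) (of_real t) = poly q (of_real t) * U $$ (r, s) \<and>
          poly (PZ $$ (r, s)) (of_real t) = poly q (of_real t) * mat_adjoint U $$ (r, s))"
    using unitary_path[OF X Z XZ ZX] by blast
  \<comment> \<open>The words of \<open>p\<close> have different lengths; the extra powers of \<open>q\<close> bring them to the common
    denominator \<open>q ^ ?u\<close>.\<close>
  define F where "F = (\<Sum>w\<in>Poly_Mapping.keys p. [:Poly_Mapping.lookup p w:] * q ^ (?u - length (letters w)) *
      word_entry n (mat_rep n PX PZ) (letters w) a b)"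
  have F: "poly F t = poly q t ^ ?u * poly_entry n (mat_rep n U V) p a b"
    if U: "\<And>r s. r < ?m \<Longrightarrow> s < ?m \<Longrightarrow> poly (PX $$ (r, s)) t = poly q t * U $$ (r, s)"
      and V: "\<And>r s. r < ?m \<Longrightarrow> s < ?m \<Longrightarrow> poly (PZ $$ (r, s)) t = poly q t * V $$ (r, s)" for t U V
  proof -
    have "poly q t ^ (?u - length (letters w)) * poly (word_entry n (mat_rep n PX PZ) (letters w) a b) t
        = poly q t ^ ?u * word_entry n (mat_rep n U V) (letters w) a b"
      if w: "w \<in> Poly_Mapping.keys p" for w
    proof -
      have ok: "letter_ok g l" if "l \<in> set (letters w)" for l
        using p w that by auto
      have len: "length (letters w) \<le> ?u"
        unfolding nc_degree_def using w by (intro Max_ge) auto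
      have "poly (word_entry n (mat_rep n PX PZ) (letters w) a b) t =
          word_entry n (\<lambda>l a c. poly q t * mat_rep n U V l a c) (letters w) a b"
        unfolding poly_word_entry
      proof (rule word_entry_cong)
        fix l a c assume l: "l \<in> set (letters w)" and ac: "a < n" "c < n"
        show "poly (mat_rep n PX PZ l a c) t = poly q t * mat_rep n U V l a c"
          using ok[OF l] ac by (cases l) (auto simp: mat_rep_def U V flat_index_less)
      qed (rule ab)
      also have "\<dots> = poly q t ^ length (letters w) * word_entry n (mat_rep n U V) (letters w) a b"
        by (rule word_entry_scale)
      finally show ?thesis
        using len by (simp add: power_add[symmetric] mult.assoc[symmetric])
    qed
    then show ?thesis
      by (simp add: F_def poly_entry_def poly_sum sum_distrib_left mult_ac)
  qed
  have zero: "poly F (of_real t) = 0" if t: "poly q (of_real t) \<noteq> 0" for t :: real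
  proof -
    obtain U where U: "U \<in> carrier_mat ?m ?m" "mat_adjoint U * U = 1\<^sub>m ?m"
      and eq: "\<And>r s. r < ?m \<Longrightarrow> s < ?m \<Longrightarrow> poly (PX $$ (r, s)) (of_real t) = poly q (of_real t) * U $$ (r, s)"
         "\<And>r s. r < ?m \<Longrightarrow> s < ?m \<Longrightarrow> poly (PZ $$ (r, s)) (of_real t) = poly q (of_real t) * mat_adjoint U $$ (r, s)"
      using unitary[OF t] by blast
    let ?A = "\<lambda>i j. mat n n (\<lambda>(a, c). U $$ (i * n + a, j * n + c))"
    have "partitioned_unitary g n ?A"
      unfolding partitioned_unitary_def nc_eval_blocks(1)[OF U(1) p ab] using U(2) by simp
    then have "nc_eval n ?A p = 0\<^sub>m n n" using van by blast
    then have "poly_entry n (mat_rep n U (mat_adjoint U)) p a b = 0"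
      using ab by (simp flip: nc_eval_blocks(2)[OF U(1) p ab])
    then show ?thesis using F[OF eq] by simp
  qed
  have "q \<noteq> 0" using q by auto
  have "F = 0"
  proof (rule ccontr)
    assume "F \<noteq> 0"
    then have "finite ({t. poly F t = 0} \<union> {t. poly q t = 0})"
      using \<open>q \<noteq> 0\<close> by (simp add: poly_roots_finite)
    moreover have "range (of_real :: real \<Rightarrow> complex) \<subseteq> {t. poly F t = 0} \<union> {t. poly q t = 0}"
      using zero by auto
    ultimately have "finite (range (of_real :: real \<Rightarrow> complex))"
      by (rule finite_subset[rotated])
    then show False
      using finite_imageD[of "of_real :: real \<Rightarrow> complex" UNIV] infinite_UNIV_char_0[where 'a = real]
      by (simp add: inj_on_def)
  qed
  then have "poly_entry n (mat_rep n X Z) p a b = 0"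
    using F[OF PX PZ] q by simp
  moreover have "poly_entry n (mat_rep n X Z) p a b = poly_entry n E p a b"
    unfolding poly_entry_def
  proof (intro sum.cong refl arg_cong2[where f = "(*)"] word_entry_cong)
    fix w l a c assume w: "w \<in> Poly_Mapping.keys p" "l \<in> set (letters w)" and ac: "a < n" "c < n"
    have "letter_ok g l" using p w by auto
    then show "mat_rep n X Z l a c = E l a c"
      using ac by (cases l) (auto simp: mat_rep_def X_def Z_def flat_index_less)
  qed (rule ab)
  ultimately show ?thesis by simp
qed

section \<open>Monomials\<close>

text \<open>
  The \<open>g \<times> g\<close> matrix \<open>1 + J\<close>, with \<open>J\<close> the matrix of ones, and its inverse \<open>1 - J / (g + 1)\<close>: none of
  their entries is zero.
\<close>

definition scalar_rep :: "nat \<Rightarrow> letter \<Rightarrow> nat \<Rightarrow> nat \<Rightarrow> complex" where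
  "scalar_rep g l a c = of_bool (a = c) *
     (case l of Var i j \<Rightarrow> of_bool (i = j) + 1 | VarT i j \<Rightarrow> of_bool (i = j) - 1 / (of_nat g + 1))"

lemma scalar_rep_inverse_pair: "inverse_pair_rep g n (scalar_rep g)"
proof -
  have pos: "of_nat g + 1 \<noteq> (0::complex)"
    by (metis of_nat_1 of_nat_add of_nat_eq_0_iff add_is_0 zero_neq_one)
  have inv: "(\<Sum>j<g. (of_bool (i = j) + 1) * (of_bool (k = j) - 1 / (of_nat g + 1))) = (of_bool (i = k) :: complex)"
    if "i < g" "k < g" for i k
  proof -
    have "(\<Sum>j<g. (of_bool (i = j) + 1) * (of_bool (k = j) - 1 / (of_nat g + 1))) =
        (\<Sum>j<g. (if j = i then of_bool (i = k) else 0) + (if j = k then 1 else 0)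
           - (if j = i then 1 / (of_nat g + 1) else 0) - 1 / (of_nat g + 1 :: complex))"
      by (intro sum.cong refl) (auto simp: algebra_simps)
    also have "\<dots> = of_bool (i = k) + 1 - 1 / (of_nat g + 1) - of_nat g * (1 / (of_nat g + 1))"
      using that by (simp add: sum.distrib sum_subtractf)
    also have "\<dots> = of_bool (i = k)"
    proof -
      have "1 / (of_nat g + 1) + of_nat g * (1 / (of_nat g + 1)) = (1 + of_nat g) / (of_nat g + 1 :: complex)"
        by (simp add: add_divide_distrib)
      also have "\<dots> = 1" using pos by (simp add: add.commute)
      finally show ?thesis by (simp add: diff_diff_eq)
    qed
    finally show ?thesis .
  qed
  have collapse: "(\<Sum>c<n. of_bool (a = c) * x * (of_bool (c = b) * y)) = of_bool (a = b) * (x * y)"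
    if "a < n" for a b and x y :: complex
  proof -
    have "(\<Sum>c<n. of_bool (a = c) * x * (of_bool (c = b) * y)) = (\<Sum>c<n. if c = a then of_bool (a = b) * (x * y) else 0)"
      by (intro sum.cong refl) auto
    then show ?thesis using that by simp
  qed
  show ?thesis
    unfolding inverse_pair_rep_def scalar_rep_def letter.case
  proof (intro allI impI conjI)
    fix i k a b assume ik: "i < g" "k < g" and "a < n" "b < n"
    note c = collapse[OF \<open>a < n\<close>, of _ b]
    show "(\<Sum>j<g. \<Sum>c<n. of_bool (a = c) * (of_bool (i = j) + 1) * (of_bool (c = b) * (of_bool (k = j) - 1 / (of_nat g + 1))))
        = (of_bool (i = k \<and> a = b) :: complex)"
      unfolding c sum_distrib_left[symmetric] inv[OF ik] by auto
    have "(\<Sum>j<g. (of_bool (j = i) - 1 / (of_nat g + 1)) * (of_bool (j = k) + 1)) =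
        (\<Sum>j<g. (of_bool (k = j) + 1) * (of_bool (i = j) - 1 / (of_nat g + 1 :: complex)))"
      by (intro sum.cong refl) auto
    also have "\<dots> = of_bool (k = i)" by (rule inv[OF ik(2,1)])
    finally have inv': "(\<Sum>j<g. (of_bool (j = i) - 1 / (of_nat g + 1)) * (of_bool (j = k) + 1)) = (of_bool (k = i) :: complex)" .
    show "(\<Sum>j<g. \<Sum>c<n. of_bool (a = c) * (of_bool (j = i) - 1 / (of_nat g + 1)) * (of_bool (c = b) * (of_bool (j = k) + 1)))
        = (of_bool (i = k \<and> a = b) :: complex)"
      unfolding c sum_distrib_left[symmetric] inv' by auto
  qed
qed

lemma scalar_rep_word_nonzero:
  assumes "0 < g" "a < n"
  shows "word_entry n (scalar_rep g) w a a \<noteq> 0"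
proof (induction w)
  case (Cons l w)
  define s where "s = (case l of Var i j \<Rightarrow> of_bool (i = j) + 1 | VarT i j \<Rightarrow> of_bool (i = j) - 1 / (of_nat g + 1 :: complex))"
  have pos: "of_nat g + 1 \<noteq> (0::complex)"
    by (metis of_nat_1 of_nat_add of_nat_eq_0_iff add_is_0 zero_neq_one)
  have "s \<noteq> 0"
    using pos \<open>0 < g\<close> by (cases l) (auto simp: s_def field_simps)
  have "word_entry n (scalar_rep g) (l # w) a a = (\<Sum>c<n. if c = a then s * word_entry n (scalar_rep g) w a a else 0)"
    unfolding word_entry.simps by (intro sum.cong refl) (auto simp: scalar_rep_def s_def)
  then show ?case
    using Cons \<open>s \<noteq> 0\<close> \<open>a < n\<close> by simp
qed simp

section \<open>Bidiagonal representations\<close>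

text \<open>
  A word of length \<open>m\<close> climbs at most \<open>m\<close> states, and it climbs exactly \<open>m\<close> states only by taking the
  superdiagonal entry of every letter.
\<close>

lemma word_entry_bidiagonal:
  assumes E: "\<And>l a c. c \<noteq> a \<Longrightarrow> c \<noteq> Suc a \<Longrightarrow> E l a c = 0"
  shows "a + length w < b \<Longrightarrow> word_entry n E w a b = 0"
    and "b = a + length w \<Longrightarrow> b < n \<Longrightarrow>
      word_entry n E w a b = (\<Prod>k<length w. E (w ! k) (a + k) (Suc (a + k)))"
proof -
  have step: "word_entry n E (l # w) a b =
      E l a a * word_entry n E w a b + (if Suc a < n then E l a (Suc a) * word_entry n E w (Suc a) b else 0)"
    if "a < n" for l w a b
  proof -
    have "word_entry n E (l # w) a b = (\<Sum>c\<in>{c. c < n \<and> (c = a \<or> c = Suc a)}. E l a c * word_entry n E w c b)"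
      unfolding word_entry.simps by (rule sum.mono_neutral_right) (auto simp: E)
    also have "{c. c < n \<and> (c = a \<or> c = Suc a)} = (if Suc a < n then {a, Suc a} else {a})"
      using that by auto
    finally show ?thesis by simp
  qed
  have none: "word_entry n E (l # w) a b = 0" if "\<not> a < n" "\<And>c. c < n \<Longrightarrow> word_entry n E w c b = 0" for l w a b
    using that by simp
  show zero: "a + length w < b \<Longrightarrow> word_entry n E w a b = 0" for a w
  proof (induction w arbitrary: a)
    case (Cons l w)
    show ?case
    proof (cases "a < n")
      case True
      then show ?thesis using Cons by (simp only: step) simp
    next
      case False
      then show ?thesis using Cons by (intro none) auto
    qed
  qed simp
  show "b = a + length w \<Longrightarrow> b < n \<Longrightarrow>
      word_entry n E w a b = (\<Prod>k<length w. E (w ! k) (a + k) (Suc (a + k)))"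
  proof (induction w arbitrary: a)
    case (Cons l w)
    then have "word_entry n E (l # w) a b = E l a (Suc a) * word_entry n E w (Suc a) b"
      using zero[of a w] by (subst step) auto
    also have "word_entry n E w (Suc a) b = (\<Prod>k<length w. E (w ! k) (Suc a + k) (Suc (Suc a + k)))"
      using Cons by auto
    finally show ?case
      unfolding length_Cons prod.lessThan_Suc_shift by simp
  qed simp
qed

text \<open>
  The data attached to one state of the chain. \<open>Q\<close> and \<open>R\<close> are the diagonal blocks of \<open>X\<close> and \<open>Z\<close>;
  \<open>y\<close> and \<open>y'\<close> are the row vectors by which the step arriving at the state ends, for \<open>X\<close> and \<open>Z\<close>, and
  \<open>x\<close> and \<open>x'\<close> the column vectors by which the step leaving it begins. The equations say what
  \<open>X Z = 1 = Z X\<close> demands: those in which \<open>Q\<close> and \<open>R\<close> act on vectors make the superdiagonal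
  of the products vanish, and the orthogonality relations do this one diagonal higher.
\<close>

definition junction :: "nat \<Rightarrow> (nat \<Rightarrow> complex) \<Rightarrow> (nat \<Rightarrow> complex) \<Rightarrow> (nat \<Rightarrow> complex) \<Rightarrow> (nat \<Rightarrow> complex)
    \<Rightarrow> (nat \<Rightarrow> nat \<Rightarrow> complex) \<Rightarrow> (nat \<Rightarrow> nat \<Rightarrow> complex) \<Rightarrow> bool" where
  "junction g y y' x x' Q R \<longleftrightarrow>
     (\<forall>i<g. \<forall>k<g. (\<Sum>j<g. Q i j * R j k) = of_bool (i = k)) \<and>
     (\<forall>i<g. \<forall>k<g. (\<Sum>j<g. R i j * Q j k) = of_bool (i = k)) \<and>
     (\<forall>k<g. (\<Sum>j<g. y' j * Q j k) = y k) \<and>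
     (\<forall>k<g. (\<Sum>j<g. y j * R j k) = y' k) \<and>
     (\<forall>i<g. (\<Sum>j<g. Q i j * x' j) = - x i) \<and>
     (\<forall>i<g. (\<Sum>j<g. R i j * x j) = - x' i) \<and>
     (\<Sum>j<g. y j * x' j) = 0 \<and> (\<Sum>j<g. y' j * x j) = 0"

definition bidiagonal :: "(nat \<Rightarrow> complex) \<Rightarrow> (nat \<Rightarrow> complex) \<Rightarrow> nat \<Rightarrow> nat \<Rightarrow> complex" where
  "bidiagonal D S a c = (if c = a then D a else if c = Suc a then S a else 0)"

lemma bidiagonal_mult:
  assumes "a < n" "b < n"
  shows "(\<Sum>c<n. bidiagonal D S a c * bidiagonal D' S' c b) =
    (if b = a then D a * D' a
     else if b = Suc a then D a * S' a + S a * D' (Suc a)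
     else if b = Suc (Suc a) then S a * S' (Suc a) else 0)"
proof -
  have "(\<Sum>c<n. bidiagonal D S a c * bidiagonal D' S' c b) =
      (\<Sum>c\<in>(if Suc a < n then {a, Suc a} else {a}). bidiagonal D S a c * bidiagonal D' S' c b)"
    using assms by (intro sum.mono_neutral_right) (auto simp: bidiagonal_def)
  then show ?thesis
    using assms by (auto simp: bidiagonal_def)
qed

definition chain_rep ::
  "(nat \<Rightarrow> nat \<Rightarrow> complex) \<Rightarrow> (nat \<Rightarrow> nat \<Rightarrow> complex) \<Rightarrow> (nat \<Rightarrow> nat \<Rightarrow> complex) \<Rightarrow> (nat \<Rightarrow> nat \<Rightarrow> complex)
    \<Rightarrow> (nat \<Rightarrow> nat \<Rightarrow> nat \<Rightarrow> complex) \<Rightarrow> (nat \<Rightarrow> nat \<Rightarrow> nat \<Rightarrow> complex) \<Rightarrow> letter \<Rightarrow> nat \<Rightarrow> nat \<Rightarrow> complex" where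
  "chain_rep y y' x x' Q R l =
     (if plain l
      then bidiagonal (\<lambda>a. Q a (row_index l) (col_index l)) (\<lambda>a. x a (row_index l) * y (Suc a) (col_index l))
      else bidiagonal (\<lambda>a. R a (row_index l) (col_index l)) (\<lambda>a. x' a (row_index l) * y' (Suc a) (col_index l)))"

lemma chain_rep_inverse_pair:
  assumes J: "\<And>a. junction g (y a) (y' a) (x a) (x' a) (Q a) (R a)"
  shows "inverse_pair_rep g n (chain_rep y y' x x' Q R)"
proof -
  have main: "(\<Sum>j<g. \<Sum>c<n. bidiagonal (\<lambda>a. Q a i j) (\<lambda>a. x a i * y (Suc a) j) a c
        * bidiagonal (\<lambda>a. R a j k) (\<lambda>a. x' a j * y' (Suc a) k) c b) = of_bool (i = k \<and> a = b)"
    if J: "\<And>a. junction g (y a) (y' a) (x a) (x' a) (Q a) (R a)"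
      and ik: "i < g" "k < g" and ab: "a < n" "b < n"
    for Q R :: "nat \<Rightarrow> nat \<Rightarrow> nat \<Rightarrow> complex" and x x' y y' i k a b
  proof -
    note J' = J[unfolded junction_def]
    have diag: "(\<Sum>j<g. Q a i j * R a j k) = of_bool (i = k)"
      using J'[of a] ik by blast
    have "(\<Sum>j<g. Q a i j * (x' a j * y' (Suc a) k) + x a i * y (Suc a) j * R (Suc a) j k) =
        (\<Sum>j<g. Q a i j * x' a j) * y' (Suc a) k + x a i * (\<Sum>j<g. y (Suc a) j * R (Suc a) j k)"
      by (simp add: sum.distrib sum_distrib_left sum_distrib_right mult_ac)
    also have "\<dots> = 0"
      using J'[of a] J'[of "Suc a"] ik by simp
    finally have super: "(\<Sum>j<g. Q a i j * (x' a j * y' (Suc a) k) + x a i * y (Suc a) j * R (Suc a) j k) = 0" .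
    have "(\<Sum>j<g. x a i * y (Suc a) j * (x' (Suc a) j * y' (Suc (Suc a)) k)) =
        x a i * (\<Sum>j<g. y (Suc a) j * x' (Suc a) j) * y' (Suc (Suc a)) k"
      by (simp add: sum_distrib_left sum_distrib_right mult_ac)
    also have "\<dots> = 0"
      using J'[of "Suc a"] by simp
    finally have supersuper: "(\<Sum>j<g. x a i * y (Suc a) j * (x' (Suc a) j * y' (Suc (Suc a)) k)) = 0" .
    show ?thesis
      using ab diag super supersuper
      by (cases "b = a"; cases "b = Suc a"; cases "b = Suc (Suc a)") (auto simp: bidiagonal_mult)
  qed
  \<comment> \<open>The definition of a junction is symmetric under exchanging the two halves of the data.\<close>
  have sym: "junction g (y' a) (y a) (x' a) (x a) (R a) (Q a)" for a
    using J[of a] unfolding junction_def by blast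
  show ?thesis
    unfolding inverse_pair_rep_def
  proof (intro allI impI conjI)
    fix i k a b assume "i < g" "k < g" "a < n" "b < n"
    then show "(\<Sum>j<g. \<Sum>c<n. chain_rep y y' x x' Q R (Var i j) a c * chain_rep y y' x x' Q R (VarT k j) c b)
          = of_bool (i = k \<and> a = b)"
        "(\<Sum>j<g. \<Sum>c<n. chain_rep y y' x x' Q R (VarT j i) a c * chain_rep y y' x x' Q R (Var j k) c b)
          = of_bool (i = k \<and> a = b)"
      using main[where y = y and y' = y' and x = x and x' = x' and Q = Q and R = R, OF J, of i k a b]
        main[where y = y' and y' = y and x = x' and x' = x and Q = R and R = Q, OF sym, of i k a b]
      by (simp_all add: chain_rep_def)
  qed
qed

text \<open>
  Monomial matrices \<open>Q\<close>, with the entries \<open>q k\<close> placed along an involution \<open>s\<close>, are general enough: the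
  identity and the transpositions give all the junctions that are needed. The row vector \<open>y'\<close> and
  the column vector \<open>x'\<close> are free up to the one orthogonality condition.
\<close>

lemma junction_monomial:
  fixes q y' x' :: "nat \<Rightarrow> complex"
  assumes s: "\<And>k. k < g \<Longrightarrow> s k < g" "\<And>k. k < g \<Longrightarrow> s (s k) = k"
    and q: "\<And>k. k < g \<Longrightarrow> q k \<noteq> 0"
    and orth: "(\<Sum>k<g. y' k * q k * x' (s k)) = 0"
  shows "\<exists>Q R. junction g (\<lambda>j. y' (s j) * q (s j)) y' (\<lambda>i. - q i * x' (s i)) x' Q R"
proof (intro exI)
  have eq: "(j = s i) \<longleftrightarrow> (i = s j)" if "i < g" "j < g" for i j
    using s that by metis
  have pick: "(\<Sum>j<g. if j = s i then f j else 0) = f (s i)" if "i < g" for i and f :: "nat \<Rightarrow> complex"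
    using s(1)[OF that] by simp
  have pick': "(\<Sum>j<g. if i = s j then f j else 0) = f (s i)" if "i < g" for i and f :: "nat \<Rightarrow> complex"
  proof -
    have "(\<Sum>j<g. if i = s j then f j else 0) = (\<Sum>j<g. if j = s i then f j else 0)"
      using that by (intro sum.cong refl) (simp add: eq)
    then show ?thesis using pick[OF that] by simp
  qed
  let ?Q = "\<lambda>i j. if j = s i then q i else 0"
  let ?R = "\<lambda>i j. if i = s j then 1 / q j else 0"
  have "(\<Sum>j<g. y' (s j) * q (s j) * x' j) = (\<Sum>k<g. y' k * q k * x' (s k))"
    by (rule sum.reindex_bij_witness[of _ s s]) (auto simp: s)
  then have orth': "(\<Sum>j<g. y' (s j) * q (s j) * x' j) = 0"
    using orth by simp
  have inj: "s i = s j \<longleftrightarrow> i = j" if "i < g" "j < g" for i j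
    using s that by metis
  show "junction g (\<lambda>j. y' (s j) * q (s j)) y' (\<lambda>i. - q i * x' (s i)) x' ?Q ?R"
    unfolding junction_def
    using orth orth' s q
    by (auto simp: if_distrib[of "\<lambda>x. _ * x"] if_distrib[of "\<lambda>x. x * _"] pick pick' inj sum_negf mult.assoc
        cong: if_cong)
qed

section \<open>The span of the junction functions\<close>

text \<open>
  The factor that a junction contributes to the value of a word, as a function of the type \<open>s\<close>
  (plain or not) and column \<open>j\<close> of the letter before it and the type \<open>t\<close> and row \<open>i\<close> of the letter
  after it.
\<close>

definition junction_fun :: "(nat \<Rightarrow> complex) \<Rightarrow> (nat \<Rightarrow> complex) \<Rightarrow> (nat \<Rightarrow> complex) \<Rightarrow> (nat \<Rightarrow> complex)
    \<Rightarrow> bool \<Rightarrow> nat \<Rightarrow> bool \<Rightarrow> nat \<Rightarrow> complex" where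
  "junction_fun y y' x x' s j t i = (if s then y j else y' j) * (if t then x i else x' i)"

text \<open>
  The linear span of the junction functions, regarded as functions on the pairs of letters that do
  not collide: values outside this set are irrelevant by the rule \<open>cong\<close>.
\<close>

inductive junction_span :: "nat \<Rightarrow> (bool \<Rightarrow> nat \<Rightarrow> bool \<Rightarrow> nat \<Rightarrow> complex) \<Rightarrow> bool" for g where
  junction: "junction g y y' x x' Q R \<Longrightarrow> junction_span g (junction_fun y y' x x')"
| add: "junction_span g J \<Longrightarrow> junction_span g J' \<Longrightarrow> junction_span g (\<lambda>s j t i. J s j t i + J' s j t i)"
| scale: "junction_span g J \<Longrightarrow> junction_span g (\<lambda>s j t i. c * J s j t i)"
| cong: "junction_span g J \<Longrightarrow>
    (\<And>s j t i. j < g \<Longrightarrow> i < g \<Longrightarrow> \<not> (s \<noteq> t \<and> j = 0 \<and> i = 0) \<Longrightarrow> J' s j t i = J s j t i) \<Longrightarrow>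
    junction_span g J'"

definition junction_unit :: "bool \<Rightarrow> nat \<Rightarrow> bool \<Rightarrow> nat \<Rightarrow> bool \<Rightarrow> nat \<Rightarrow> bool \<Rightarrow> nat \<Rightarrow> complex" where
  "junction_unit s0 j0 t0 i0 s j t i = of_bool (s = s0 \<and> j = j0 \<and> t = t0 \<and> i = i0)"

lemma junction_span_monomial:
  fixes q y' x' :: "nat \<Rightarrow> complex"
  assumes "\<And>k. k < g \<Longrightarrow> s k < g" "\<And>k. k < g \<Longrightarrow> s (s k) = k"
    and "\<And>k. k < g \<Longrightarrow> q k \<noteq> 0" and "(\<Sum>k<g. y' k * q k * x' (s k)) = 0"
  shows "junction_span g (junction_fun (\<lambda>j. y' (s j) * q (s j)) y' (\<lambda>i. - q i * x' (s i)) x')"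
  using junction_monomial[OF assms] junction_span.junction by blast

lemma junction_span_zero: "junction_span g (\<lambda>s j t i. 0)"
proof -
  have "junction_span g (junction_fun (\<lambda>j. 0 * 1) (\<lambda>j. 0) (\<lambda>i. - 1 * 0) (\<lambda>i. 0))"
    by (rule junction_span_monomial[where s = id]) auto
  from junction_span.scale[OF this, of 0] show ?thesis by simp
qed

lemma junction_span_combination:
  assumes "\<And>r. r \<in> S \<Longrightarrow> junction_span g (J r)"
  shows "junction_span g (\<lambda>s j t i. \<Sum>r\<in>S. c r * J r s j t i)"
  using assms
proof (induction S rule: infinite_finite_induct)
  case (insert r S)
  then show ?case
    using junction_span.add[OF junction_span.scale[of g "J r" "c r"]] by simp
qed (simp_all add: junction_span_zero)

lemma junction_span_linear:
  assumes "junction_span g J" "junction_span g J'"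
  shows "junction_span g (\<lambda>s j t i. c * J s j t i + c' * J' s j t i)"
  using assms by (intro junction_span.add junction_span.scale)

text \<open>
  For \<open>j0 \<noteq> i0\<close> the coordinate vectors at \<open>j0\<close> and \<open>i0\<close> satisfy the orthogonality condition for every
  diagonal \<open>Q\<close>. The four types of pairs then receive the weights \<open>a\<close> or 1 times \<open>-b\<close> or 1, with free
  nonzero parameters \<open>a\<close> and \<open>b\<close>, so the values 1 and 2 of the parameters separate them.
\<close>

lemma junction_span_off_diagonal:
  assumes "j0 < g" "i0 < g" "j0 \<noteq> i0"
  shows "junction_span g (junction_unit s0 j0 t0 i0)"
proof -
  define G :: "complex \<Rightarrow> complex \<Rightarrow> bool \<Rightarrow> nat \<Rightarrow> bool \<Rightarrow> nat \<Rightarrow> complex"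
    where "G a b s j t i = of_bool (j = j0 \<and> i = i0) * (if s then a else 1) * (if t then - b else 1)" for a b s j t i
  have G: "junction_span g (G a b)" if "a \<noteq> 0" "b \<noteq> 0" for a b
  proof (rule junction_span.cong)
    show "junction_span g (junction_fun
        (\<lambda>j. of_bool (id j = j0) * (if id j = j0 then a else b)) (\<lambda>j. of_bool (j = j0))
        (\<lambda>i. - (if i = j0 then a else b) * of_bool (id i = i0)) (\<lambda>i. of_bool (i = i0)))"
      using that assms
      by (intro junction_span_monomial) (auto intro!: sum.neutral)
  qed (use assms in \<open>auto simp: G_def junction_fun_def\<close>)
  define c where "c s = (if s then - 1 else 2 :: complex)" for s
  define d where "d s = (if s then 1 else - 1 :: complex)" for s
  define H where "H a s j t i = c t0 * G a 1 s j t i + d t0 * G a 2 s j t i" for a s j t i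
  have "junction_span g (H a)" if "a \<noteq> 0" for a
    unfolding H_def using that by (intro junction_span_linear G) auto
  then have "junction_span g (\<lambda>s j t i. (if t0 then - 1 else 1) * (c s0 * H 1 s j t i + d s0 * H 2 s j t i))"
    by (intro junction_span.scale junction_span_linear) auto
  then show ?thesis
    by (rule junction_span.cong)
      (auto simp: H_def G_def c_def d_def junction_unit_def)
qed

definition swap_index :: "nat \<Rightarrow> nat \<Rightarrow> nat \<Rightarrow> nat" where
  "swap_index a b k = (if k = a then b else if k = b then a else k)"

text \<open>
  With \<open>Q\<close> a weighted transposition, the coordinate vector at \<open>j0\<close> may be used on both sides. Up to
  off-diagonal units the junction function is the unit of type \<open>False\<close> at \<open>j0\<close> minus \<open>a\<close> times the unit
  of type \<open>True\<close> at \<open>k0\<close>, and two values of \<open>a\<close> separate the two.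
\<close>

lemma junction_span_equal_type:
  assumes "j0 < g" "k0 < g" "j0 \<noteq> k0"
  shows "junction_span g (junction_unit True k0 True k0)"
    and "junction_span g (junction_unit False j0 False j0)"
proof -
  define D :: "complex \<Rightarrow> bool \<Rightarrow> nat \<Rightarrow> bool \<Rightarrow> nat \<Rightarrow> complex"
    where "D a s j t i = (if s then a * of_bool (j = k0) else of_bool (j = j0))
        * (if t then - of_bool (i = k0) else of_bool (i = j0))" for a s j t i
  have D: "junction_span g (D a)" if "a \<noteq> 0" for a
  proof (rule junction_span.cong)
    let ?s = "swap_index j0 k0" and ?q = "\<lambda>k. if k = j0 then a else 1"
    show "junction_span g (junction_fun
        (\<lambda>j. of_bool (?s j = j0) * ?q (?s j)) (\<lambda>j. of_bool (j = j0))
        (\<lambda>i. - ?q i * of_bool (?s i = j0)) (\<lambda>i. of_bool (i = j0)))"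
      using that assms
      by (intro junction_span_monomial) (auto simp: swap_index_def intro!: sum.neutral)
  qed (use assms in \<open>auto simp: D_def junction_fun_def swap_index_def\<close>)
  have D12: "junction_span g (\<lambda>s j t i. c * D 1 s j t i + - 1 * D 2 s j t i)" for c
    by (intro junction_span_linear D) auto
  show "junction_span g (junction_unit True k0 True k0)"
    by (rule junction_span.cong[OF junction_span.add[OF D12[of 1]
            junction_span_off_diagonal[of k0 g j0 True False]]])
      (use assms in \<open>auto simp: D_def junction_unit_def\<close>)
  show "junction_span g (junction_unit False j0 False j0)"
    by (rule junction_span.cong[OF junction_span.add[OF D12[of 2]
            junction_span_off_diagonal[of j0 g k0 False True]]])
      (use assms in \<open>auto simp: D_def junction_unit_def\<close>)
qed

text \<open>
  By the two preceding lemmas all units are in the span except those with \<open>j = i\<close> and different types;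
  so any function in the span may be truncated to these positions.
\<close>

lemma junction_span_mixed_diagonal_part:
  assumes "1 < g" "junction_span g J"
  shows "junction_span g (\<lambda>s j t i. if j = i \<and> s \<noteq> t then J s j t i else 0)"
proof -
  define S where "S = {(s, j, t, i). j < g \<and> i < g \<and> \<not> (j = i \<and> s \<noteq> (t::bool))}"
  have "S \<subseteq> UNIV \<times> {..<g} \<times> UNIV \<times> {..<g}"
    by (auto simp: S_def)
  then have fin: "finite S"
    by (rule finite_subset) auto
  have unit: "junction_span g (junction_unit s j t i)" if S: "(s, j, t, i) \<in> S" for s j t i
  proof (cases "j = i")
    case True
    then have "j < g" "s = t" using S by (auto simp: S_def)
    moreover obtain k where "k < g" "k \<noteq> j"
      using assms that[of 0] that[of 1] by (cases "j = 0") simp_all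
    ultimately have "junction_span g (junction_unit s j s j)"
      using junction_span_equal_type[of k g j] junction_span_equal_type[of j g k] by (cases s) simp_all
    then show ?thesis using True \<open>s = t\<close> by simp
  next
    case False
    then show ?thesis using S by (auto simp: S_def intro: junction_span_off_diagonal)
  qed
  define f where "f = (\<lambda>(s, j, t, i). J s j t i)"
  define U where "U = (\<lambda>(s, j, t, i). junction_unit s j t i)"
  have "junction_span g (\<lambda>s j t i. \<Sum>r\<in>S. f r * U r s j t i)"
    using unit by (intro junction_span_combination) (auto simp: U_def)
  moreover have "(\<Sum>r\<in>S. f r * U r s j t i) = (if (s, j, t, i) \<in> S then J s j t i else 0)" for s j t i
  proof -
    have "(\<Sum>r\<in>S. f r * U r s j t i) = (\<Sum>r\<in>S. if r = (s, j, t, i) then f r else 0)"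
      by (intro sum.cong refl) (auto simp: U_def junction_unit_def)
    then show ?thesis using fin by (simp add: f_def)
  qed
  ultimately have "junction_span g (\<lambda>s j t i. if (s, j, t, i) \<in> S then J s j t i else 0)"
    by simp
  from junction_span_linear[OF assms(2) this, of 1 "- 1"] show ?thesis
    by (rule junction_span.cong) (auto simp: S_def)
qed

text \<open>
  This is the place where collisions matter: the orthogonality condition couples the diagonal
  positions of mixed type, and any of them can be isolated only modulo the position 0, which is
  the colliding one. With vectors supported on \<open>{0, j0}\<close> and up to the units already found, the choice \<open>Q = 1\<close> gives the difference of
  the two mixed units at \<open>j0\<close>, and the transposition of 0 and \<open>j0\<close> gives the negative of their sum.
\<close>

lemma junction_span_mixed_diagonal:
  assumes "0 < j0" "j0 < g"
  shows "junction_span g (junction_unit True j0 False j0)"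
    and "junction_span g (junction_unit False j0 True j0)"
proof -
  let ?y = "\<lambda>j. of_bool (j = j0) + of_bool (j = 0) :: complex"
  let ?x = "\<lambda>j. of_bool (j = j0) - of_bool (j = 0) :: complex"
  let ?s = "swap_index 0 j0"
  have "(\<Sum>k<g. ?y k * 1 * ?x (id k)) = (\<Sum>k\<in>{0, j0}. ?y k * 1 * ?x (id k))"
    using assms by (intro sum.mono_neutral_right) auto
  also have "\<dots> = 0" using assms by simp
  finally have "junction_span g (junction_fun (\<lambda>j. ?y (id j) * 1) ?y (\<lambda>i. - 1 * ?x (id i)) ?x)"
    using assms by (intro junction_span_monomial) auto
  then have raw1: "junction_span g (\<lambda>s j t i. if j = i \<and> s \<noteq> t
      then junction_fun (\<lambda>j. ?y (id j) * 1) ?y (\<lambda>i. - 1 * ?x (id i)) ?x s j t i else 0)"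
    using assms by (intro junction_span_mixed_diagonal_part) auto
  have 1: "junction_span g (\<lambda>s j t i. if j = i \<and> s \<noteq> t
      then (if s then 1 else - 1) * of_bool (j = j0) else 0)"
  proof (rule junction_span.cong[OF raw1])
    fix s t :: bool and j i :: nat assume "\<not> (s \<noteq> t \<and> j = 0 \<and> i = 0)"
    then show "(if j = i \<and> s \<noteq> t then (if s then 1 else - 1) * of_bool (j = j0) else 0) =
        (if j = i \<and> s \<noteq> t then junction_fun (\<lambda>j. ?y (id j) * 1) ?y (\<lambda>i. - 1 * ?x (id i)) ?x s j t i else 0)"
      using assms by (cases "j = i"; cases s; cases t; cases "i = j0") (simp_all add: junction_fun_def)
  qed
  have "(\<Sum>k<g. ?y k * 1 * - ?x (?s k)) = (\<Sum>k\<in>{0, j0}. ?y k * 1 * - ?x (?s k))"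
    using assms by (intro sum.mono_neutral_right) (auto simp: swap_index_def)
  also have "\<dots> = 0" using assms by (simp add: swap_index_def)
  finally have "junction_span g (junction_fun (\<lambda>j. ?y (?s j) * 1) ?y (\<lambda>i. - 1 * - ?x (?s i)) (\<lambda>i. - ?x i))"
    using assms by (intro junction_span_monomial) (auto simp: swap_index_def)
  then have raw2: "junction_span g (\<lambda>s j t i. if j = i \<and> s \<noteq> t
      then junction_fun (\<lambda>j. ?y (?s j) * 1) ?y (\<lambda>i. - 1 * - ?x (?s i)) (\<lambda>i. - ?x i) s j t i else 0)"
    using assms by (intro junction_span_mixed_diagonal_part) auto
  have 2: "junction_span g (\<lambda>s j t i. if j = i \<and> s \<noteq> t then - of_bool (j = j0) else 0)"
  proof (rule junction_span.cong[OF raw2])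
    fix s t :: bool and j i :: nat assume "\<not> (s \<noteq> t \<and> j = 0 \<and> i = 0)"
    then show "(if j = i \<and> s \<noteq> t then - of_bool (j = j0) else 0) =
        (if j = i \<and> s \<noteq> t then junction_fun (\<lambda>j. ?y (?s j) * 1) ?y (\<lambda>i. - 1 * - ?x (?s i)) (\<lambda>i. - ?x i) s j t i else 0)"
      using assms
      by (cases "j = i"; cases s; cases t; cases "i = j0") (simp_all add: junction_fun_def swap_index_def)
  qed
  have "(\<lambda>s j t i. 1 / 2 * (if j = i \<and> s \<noteq> t then (if s then 1 else - 1) * of_bool (j = j0) else 0) +
      - 1 / 2 * (if j = i \<and> s \<noteq> t then - of_bool (j = j0) else 0)) = junction_unit True j0 False j0"
    by (auto simp: fun_eq_iff junction_unit_def)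
  from this show "junction_span g (junction_unit True j0 False j0)"
    using junction_span_linear[OF 1 2, of "1 / 2" "- 1 / 2"] by (simp only:)
  have "(\<lambda>s j t i. - 1 / 2 * (if j = i \<and> s \<noteq> t then (if s then 1 else - 1) * of_bool (j = j0) else 0) +
      - 1 / 2 * (if j = i \<and> s \<noteq> t then - of_bool (j = j0) else 0)) = junction_unit False j0 True j0"
    by (auto simp: fun_eq_iff junction_unit_def)
  from this show "junction_span g (junction_unit False j0 True j0)"
    using junction_span_linear[OF 1 2, of "- 1 / 2" "- 1 / 2"] by (simp only:)
qed

lemma junction_span_unit:
  assumes "1 < g" "j0 < g" "i0 < g" "\<not> (s0 \<noteq> t0 \<and> j0 = 0 \<and> i0 = 0)"
  shows "junction_span g (junction_unit s0 j0 t0 i0)"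
proof -
  consider "j0 \<noteq> i0" | "j0 = i0" "s0 = t0" | "j0 = i0" "0 < j0" "s0 \<noteq> t0"
    using assms by auto
  then show ?thesis
  proof cases
    case 1
    then show ?thesis using assms by (intro junction_span_off_diagonal)
  next
    case 2
    obtain k where k: "k < g" "k \<noteq> j0"
      using assms that[of 0] that[of 1] by (cases "j0 = 0") simp_all
    have "junction_span g (junction_unit s0 j0 s0 j0)"
      using k assms junction_span_equal_type[of k g j0] junction_span_equal_type[of j0 g k]
      by (cases s0) simp_all
    then show ?thesis using 2 by simp
  next
    case 3
    have "junction_span g (junction_unit s0 j0 (\<not> s0) j0)"
      using 3 assms junction_span_mixed_diagonal[of j0 g] by (cases s0) simp_all
    moreover have "t0 = (\<not> s0)" using 3 by simp
    ultimately show ?thesis using 3 by simp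
  qed
qed

section \<open>Separating normal words\<close>

text \<open>
  A plain letter with both indices 1 collides with nothing; adding it at both ends makes the start
  and the end of a word junctions like all others.
\<close>

definition padded :: "letter list \<Rightarrow> letter list" where
  "padded w = Var 1 1 # w @ [Var 1 1]"

definition path_weight :: "(nat \<Rightarrow> bool \<Rightarrow> nat \<Rightarrow> bool \<Rightarrow> nat \<Rightarrow> complex) \<Rightarrow> letter list \<Rightarrow> complex" where
  "path_weight J w = (\<Prod>k\<le>length w. J k
     (plain (padded w ! k)) (col_index (padded w ! k))
     (plain (padded w ! Suc k)) (row_index (padded w ! Suc k)))"

lemma padded_good:
  assumes "1 < g" and w: "Word w \<in> normal_words g d" and k: "k \<le> length w"
  shows "col_index (padded w ! k) < g" "row_index (padded w ! Suc k) < g"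
    "\<not> (plain (padded w ! k) \<noteq> plain (padded w ! Suc k) \<and>
        col_index (padded w ! k) = 0 \<and> row_index (padded w ! Suc k) = 0)"
proof -
  have ok: "letter_ok g l" if "l \<in> set (padded w)" for l
    using that assms by (auto simp: padded_def normal_words_def)
  have idx: "row_index l < g" "col_index l < g" if "letter_ok g l" for l
    using that by (cases l; simp)+
  show "col_index (padded w ! k) < g" "row_index (padded w ! Suc k) < g"
    using k by (intro idx ok nth_mem; simp add: padded_def)+
  have "successively (\<lambda>l m. \<not> collide l m) (padded w)"
    using w by (auto simp: padded_def successively_Cons successively_append_iff normal_words_def collide_def)
  then have "\<not> collide (padded w ! k) (padded w ! Suc k)"
    using k by (auto simp: successively_conv_nth padded_def)
  then show "\<not> (plain (padded w ! k) \<noteq> plain (padded w ! Suc k) \<and>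
        col_index (padded w ! k) = 0 \<and> row_index (padded w ! Suc k) = 0)"
    by (auto simp: collide_def)
qed

lemma path_weight_upd:
  assumes "m \<le> length w"
  shows "path_weight (J(m := f)) w = f
     (plain (padded w ! m)) (col_index (padded w ! m))
     (plain (padded w ! Suc m)) (row_index (padded w ! Suc m)) *
     (\<Prod>k\<in>{..length w} - {m}. J k
     (plain (padded w ! k)) (col_index (padded w ! k))
     (plain (padded w ! Suc k)) (row_index (padded w ! Suc k)))"
  unfolding path_weight_def using assms
  by (subst prod.remove[of _ m]) auto

text \<open>
  The weight of a word is multilinear in the junction functions. A linear relation between the
  weights that holds for all choices of junctions therefore persists when the junction functions are
  replaced, one position after another, by elements of their span.
\<close>

lemma path_weight_span:
  assumes g: "1 < g"
    and K: "\<And>w. w \<in> K \<Longrightarrow> length w = d \<and> Word w \<in> normal_words g d"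
    and junction: "\<And>y y' x x' Q R. (\<And>k. junction g (y k) (y' k) (x k) (x' k) (Q k) (R k)) \<Longrightarrow>
      (\<Sum>w\<in>K. c w * path_weight (\<lambda>k. junction_fun (y k) (y' k) (x k) (x' k)) w) = 0"
    and J: "\<And>k. junction_span g (J k)"
  shows "(\<Sum>w\<in>K. c w * path_weight J w) = 0"
proof -
  define B where "B f \<longleftrightarrow> (\<exists>y y' x x' Q R. junction g y y' x x' Q R \<and> f = junction_fun y y' x x')" for f
  have base: "(\<Sum>w\<in>K. c w * path_weight J w) = 0" if "\<And>k. B (J k)" for J
  proof -
    from that have "\<forall>k. \<exists>y y' x x' Q R. junction g y y' x x' Q R \<and> J k = junction_fun y y' x x'"
      by (simp add: B_def)
    then obtain y y' x x' Q R where
      "\<And>k. junction g (y k) (y' k) (x k) (x' k) (Q k) (R k) \<and> J k = junction_fun (y k) (y' k) (x k) (x' k)"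
      by metis
    then have "J = (\<lambda>k. junction_fun (y k) (y' k) (x k) (x' k))"
        "\<And>k. junction g (y k) (y' k) (x k) (x' k) (Q k) (R k)"
      by auto
    then show ?thesis using junction[of y y' x x' Q R] by simp
  qed
  have claim: "(\<Sum>w\<in>K. c w * path_weight J w) = 0"
    if "m \<le> Suc d" "\<And>k. k < m \<Longrightarrow> junction_span g (J k)" "\<And>k. m \<le> k \<Longrightarrow> B (J k)" for m J
    using that
  proof (induction m arbitrary: J)
    case 0
    then show ?case by (intro base) simp
  next
    case (Suc m)
    have m: "m \<le> length w" if "w \<in> K" for w
      using K[OF that] Suc.prems by simp
    have "(\<Sum>w\<in>K. c w * path_weight (J(m := f)) w) = 0" if "junction_span g f" for f
      using that
    proof (induction rule: junction_span.induct)
      case (junction y y' x x' Q R)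
      then have "B (junction_fun y y' x x')"
        unfolding B_def by blast
      then show ?case
        using Suc.prems by (intro Suc.IH) auto
    next
      case (add f f')
      have "(\<Sum>w\<in>K. c w * path_weight (J(m := \<lambda>s j t i. f s j t i + f' s j t i)) w) =
          (\<Sum>w\<in>K. c w * path_weight (J(m := f)) w) + (\<Sum>w\<in>K. c w * path_weight (J(m := f')) w)"
        unfolding sum.distrib[symmetric]
        by (intro sum.cong refl) (simp only: path_weight_upd[OF m] distrib_left distrib_right)
      then show ?case using add.IH by (simp only: add_0_left)
    next
      case (scale f a)
      have "(\<Sum>w\<in>K. c w * path_weight (J(m := \<lambda>s j t i. a * f s j t i)) w) =
          a * (\<Sum>w\<in>K. c w * path_weight (J(m := f)) w)"
        by (simp add: path_weight_upd m sum_distrib_left mult_ac)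
      then show ?case using scale.IH by (simp only: mult_zero_right)
    next
      case (cong f f')
      have "path_weight (J(m := f')) w = path_weight (J(m := f)) w" if w: "w \<in> K" for w
        unfolding path_weight_upd[OF m[OF w]]
        using padded_good[OF g conjunct2[OF K[OF w]] m[OF w]] by (subst cong.hyps(2)) simp_all
      then have "(\<Sum>w\<in>K. c w * path_weight (J(m := f')) w) = (\<Sum>w\<in>K. c w * path_weight (J(m := f)) w)"
        by (intro sum.cong refl) (simp only:)
      then show ?case using cong.IH by (simp only:)
    qed
    from this[of "J m"] show ?case
      using Suc.prems by simp
  qed
  obtain f where f: "B f"
  proof -
    have "\<exists>Q R. junction g (\<lambda>j. 0 * 1) (\<lambda>j. 0) (\<lambda>i. - 1 * 0) (\<lambda>i. 0) Q R"
      by (rule junction_monomial[where s = id]) auto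
    then show ?thesis using that unfolding B_def by blast
  qed
  have "path_weight J w = path_weight (\<lambda>k. if k \<le> d then J k else f) w" if "w \<in> K" for w
    using K[OF that] by (simp add: path_weight_def)
  then have "(\<Sum>w\<in>K. c w * path_weight J w) = (\<Sum>w\<in>K. c w * path_weight (\<lambda>k. if k \<le> d then J k else f) w)"
    by simp
  also have "\<dots> = 0"
    using J f by (intro claim[of "Suc d"]) auto
  finally show ?thesis .
qed

text \<open>
  A product over steps of the chain, each with a column vector of one junction and a row vector of the
  next, is regrouped into a product over junctions. The two padding letters contribute the
  constant in front.
\<close>

lemma chain_path_weight:
  fixes w :: "letter list"
  shows "path_weight (\<lambda>k. junction_fun (y k) (y' k) (x k) (x' k)) w =
    y 0 1 * x (length w) 1 * (\<Prod>k<length w. chain_rep y y' x x' Q R (w ! k) k (Suc k))"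
proof -
  let ?Y = "\<lambda>k. if plain (padded w ! k) then y k (col_index (padded w ! k)) else y' k (col_index (padded w ! k))"
  let ?X = "\<lambda>k. if plain (padded w ! Suc k) then x k (row_index (padded w ! Suc k)) else x' k (row_index (padded w ! Suc k))"
  have nth: "padded w ! Suc k = w ! k" if "k < length w" for k
    using that by (simp add: padded_def nth_append)
  have ends: "padded w ! 0 = Var 1 1" "padded w ! Suc (length w) = Var 1 1"
    by (simp_all add: padded_def nth_append)
  have "path_weight (\<lambda>k. junction_fun (y k) (y' k) (x k) (x' k)) w = (\<Prod>k\<le>length w. ?Y k) * (\<Prod>k\<le>length w. ?X k)"
    unfolding path_weight_def junction_fun_def prod.distrib ..
  also have "(\<Prod>k\<le>length w. ?Y k) = y 0 1 * (\<Prod>k<length w. ?Y (Suc k))"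
    by (subst prod.atMost_shift) (simp add: ends)
  also have "(\<Prod>k\<le>length w. ?X k) = (\<Prod>k<length w. ?X k) * x (length w) 1"
    by (simp add: ends flip: lessThan_Suc_atMost)
  also have "y 0 1 * (\<Prod>k<length w. ?Y (Suc k)) * ((\<Prod>k<length w. ?X k) * x (length w) 1) =
      y 0 1 * x (length w) 1 * (\<Prod>k<length w. ?X k * ?Y (Suc k))"
    by (simp add: prod.distrib mult_ac)
  also have "(\<Prod>k<length w. ?X k * ?Y (Suc k)) = (\<Prod>k<length w. chain_rep y y' x x' Q R (w ! k) k (Suc k))"
    by (intro prod.cong refl) (auto simp: nth chain_rep_def bidiagonal_def)
  finally show ?thesis .
qed

text \<open>
  The functions \<open>junction_unit\<close> taken from the junctions of \<open>w0\<close> give weight 1 to \<open>w0\<close> and weight 0 to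
  every other word of the same length, since a letter is determined by its type, row and column.
\<close>

lemma top_coefficient_zero:
  assumes g: "1 < g" and "d < n"
    and q: "Poly_Mapping.keys q \<subseteq> normal_words g d"
    and vanish: "\<And>E. inverse_pair_rep g n E \<Longrightarrow> poly_entry n E q 0 d = 0"
    and w0: "Word w0 \<in> normal_words g d" "length w0 = d"
  shows "Poly_Mapping.lookup q (Word w0) = 0"
proof -
  define K where "K = {w. Word w \<in> Poly_Mapping.keys q \<and> length w = d}"
  have K: "length w = d \<and> Word w \<in> normal_words g d" if "w \<in> K" for w
    using that q by (auto simp: K_def)
  have "inj_on Word K" "Word ` K \<subseteq> Poly_Mapping.keys q"
    by (auto simp: K_def inj_on_def)
  then have finK: "finite K"
    using finite_subset[OF _ finite_keys] finite_image_iff by blast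
  have chain: "(\<Sum>w\<in>K. Poly_Mapping.lookup q (Word w) * path_weight (\<lambda>k. junction_fun (y k) (y' k) (x k) (x' k)) w) = 0"
    if J: "\<And>k. junction g (y k) (y' k) (x k) (x' k) (Q k) (R k)" for y y' x x' Q R
  proof -
    let ?E = "chain_rep y y' x x' Q R"
    have bi: "?E l a c = 0" if "c \<noteq> a" "c \<noteq> Suc a" for l a c
      using that by (simp add: chain_rep_def bidiagonal_def)
    have "0 = poly_entry n ?E q 0 d"
      by (rule vanish[symmetric]) (rule chain_rep_inverse_pair[OF J])
    also have "\<dots> = (\<Sum>w\<in>Word ` K. Poly_Mapping.lookup q w * word_entry n ?E (letters w) 0 d)"
      unfolding poly_entry_def
    proof (rule sum.mono_neutral_right)
      show "\<forall>w\<in>Poly_Mapping.keys q - Word ` K. Poly_Mapping.lookup q w * word_entry n ?E (letters w) 0 d = 0"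
      proof
        fix w assume w: "w \<in> Poly_Mapping.keys q - Word ` K"
        then have "length (letters w) < d"
          using q by (cases w) (fastforce simp: K_def normal_words_def)
        then show "Poly_Mapping.lookup q w * word_entry n ?E (letters w) 0 d = 0"
          using word_entry_bidiagonal(1)[where E = ?E, OF bi] by simp
      qed
    qed (auto simp: K_def)
    also have "\<dots> = (\<Sum>w\<in>K. Poly_Mapping.lookup q (Word w) * word_entry n ?E w 0 d)"
      by (subst sum.reindex) (auto simp: inj_on_def)
    also have "\<dots> = (\<Sum>w\<in>K. Poly_Mapping.lookup q (Word w) * (\<Prod>k<length w. ?E (w ! k) k (Suc k)))"
    proof (intro sum.cong refl)
      fix w assume "w \<in> K"
      then show "Poly_Mapping.lookup q (Word w) * word_entry n ?E w 0 d =
          Poly_Mapping.lookup q (Word w) * (\<Prod>k<length w. ?E (w ! k) k (Suc k))"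
        using word_entry_bidiagonal(2)[where E = ?E, OF bi, of d 0 w n] K[of w] \<open>d < n\<close> by simp
    qed
    finally have "(\<Sum>w\<in>K. Poly_Mapping.lookup q (Word w) * (\<Prod>k<length w. ?E (w ! k) k (Suc k))) = 0" ..
    then have "y 0 1 * x d 1 * (\<Sum>w\<in>K. Poly_Mapping.lookup q (Word w) * (\<Prod>k<length w. ?E (w ! k) k (Suc k))) = 0"
      by simp
    then show ?thesis
      by (simp add: chain_path_weight[of y y' x x' _ Q R] K sum_distrib_left mult_ac)
  qed
  define J where "J k = (if k \<le> d then junction_unit
     (plain (padded w0 ! k)) (col_index (padded w0 ! k))
     (plain (padded w0 ! Suc k)) (row_index (padded w0 ! Suc k)) else (\<lambda>s j t i. 0))" for k
  have span: "junction_span g (J k)" for k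
  proof (cases "k \<le> d")
    case True
    then show ?thesis
      unfolding J_def using padded_good[OF g w0(1), of k] w0(2) g by (simp add: junction_span_unit)
  next
    case False
    then show ?thesis
      unfolding J_def by (simp add: junction_span_zero)
  qed
  have zero: "(\<Sum>w\<in>K. Poly_Mapping.lookup q (Word w) * path_weight J w) = 0"
    using g K chain span by (rule path_weight_span)
  have J: "path_weight J w = of_bool (w = w0)" if w: "w \<in> K" for w
  proof (cases "w = w0")
    case True
    then show ?thesis using w0 by (simp add: path_weight_def J_def junction_unit_def)
  next
    case False
    have len: "length w = d" using K w by blast
    then obtain k where k: "k < d" "w ! k \<noteq> w0 ! k"
      using False w0(2) nth_equalityI by metis
    have "\<exists>k\<le>d. J k (plain (padded w ! k)) (col_index (padded w ! k))
     (plain (padded w ! Suc k)) (row_index (padded w ! Suc k)) = 0"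
    proof (rule ccontr)
      assume neg: "\<not> ?thesis"
      have eq: "plain (padded w ! m) = plain (padded w0 ! m) \<and> col_index (padded w ! m) = col_index (padded w0 ! m)
          \<and> row_index (padded w ! Suc m) = row_index (padded w0 ! Suc m)" if "m \<le> d" for m
      proof -
        have "J m (plain (padded w ! m)) (col_index (padded w ! m))
            (plain (padded w ! Suc m)) (row_index (padded w ! Suc m)) \<noteq> 0"
          using neg that by blast
        then show ?thesis
          using that by (simp add: J_def junction_unit_def)
      qed
      have "padded w ! Suc k = w ! k" "padded w0 ! Suc k = w0 ! k"
        using k len w0(2) by (simp_all add: padded_def nth_append)
      then have "plain (w ! k) = plain (w0 ! k)" "col_index (w ! k) = col_index (w0 ! k)" "row_index (w ! k) = row_index (w0 ! k)"
        using eq[of k] eq[of "Suc k"] k by simp_all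
      then show False
        using k by (cases "w ! k"; cases "w0 ! k") auto
    qed
    then have "path_weight J w = 0"
      unfolding path_weight_def by (intro prod_zero) (auto simp: len)
    then show ?thesis using False by simp
  qed
  show ?thesis
  proof (cases "w0 \<in> K")
    case True
    have "(\<Sum>w\<in>K. Poly_Mapping.lookup q (Word w) * path_weight J w) =
        (\<Sum>w\<in>K. if w = w0 then Poly_Mapping.lookup q (Word w) else 0)"
      by (intro sum.cong refl) (auto simp: J)
    then show ?thesis using zero True finK by simp
  next
    case False
    then show ?thesis using w0 by (auto simp: K_def in_keys_iff)
  qed
qed

section \<open>The Nullstellensatz\<close>

text \<open>
  The size \<open>\<lceil>g u v / 2\<rceil>\<close> is used only through two consequences. If \<open>v \<ge> 2\<close> then it is at least
  \<open>2 u \<ge> u + 1\<close>, because \<open>g \<ge> 2\<close>, and so it leaves room for a chain with \<open>u + 1\<close> states, whatever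
  the number of terms. In the remaining case \<open>p\<close> is a monomial and the size is positive.
\<close>

theorem theorem4p10:
  fixes g u v n :: nat and p :: nc_poly
  assumes "g > 1"
    and "p \<in> carrier (free_algebra g)"
    and "nc_degree p = u" and "u \<ge> 1"
    and "nc_terms p = v"
    and "n = nat \<lceil>real g / 2 * real u * real v\<rceil>"
    and "\<forall>A. partitioned_unitary g n A \<longrightarrow> nc_eval n A p = 0\<^sub>m n n"
  shows "p \<in> unitary_ideal g"
proof -
  have van: "poly_entry n E p a b = 0" if "inverse_pair_rep g n E" "a < n" "b < n" for E a b
    using vanishes_on_inverse_pairs[OF assms(7,2) that] .
  have gu: "real u \<le> real g / 2 * real u"
    using mult_right_mono[of 1 "real g / 2" "real u"] \<open>g > 1\<close> by simp
  have large: "k \<le> n" if "real k \<le> real u * real v" for k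
  proof -
    have "real u * real v \<le> real g / 2 * real u * real v"
      using gu by (rule mult_right_mono) simp
    then have "real k \<le> real g / 2 * real u * real v"
      using that by linarith
    then have "real_of_int (int k) \<le> real_of_int \<lceil>real g / 2 * real u * real v\<rceil>"
      using le_of_int_ceiling[of "real g / 2 * real u * real v"] unfolding of_int_of_nat_eq by linarith
    then have "int k \<le> \<lceil>real g / 2 * real u * real v\<rceil>"
      by (simp only: of_int_le_iff)
    then show ?thesis using assms(6) by simp
  qed
  consider "v = 0" | "v = 1" | "v \<ge> 2" by linarith
  then show ?thesis
  proof cases
    case 1
    then have "p = 0" using assms(5) by (simp add: nc_terms_def)
    then show ?thesis using unitary_ideal_zero by simp
  next
    case 2
    then obtain w where w: "Poly_Mapping.keys p = {w}"
      using assms(5) card_1_singletonE unfolding nc_terms_def by metis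
    have "0 < n" using large[of 1] 2 \<open>u \<ge> 1\<close> by simp
    then have "Poly_Mapping.lookup p w * word_entry n (scalar_rep g) (letters w) 0 0 = 0"
      using van[OF scalar_rep_inverse_pair, of 0 0] by (simp add: poly_entry_def w)
    moreover have "Poly_Mapping.lookup p w \<noteq> 0"
      using w by (simp flip: in_keys_iff)
    moreover have "word_entry n (scalar_rep g) (letters w) 0 0 \<noteq> 0"
      using scalar_rep_word_nonzero[of g 0 n] \<open>g > 1\<close> \<open>0 < n\<close> by simp
    ultimately show ?thesis by simp
  next
    case 3
    have "real (2 * u) \<le> real u * real v"
      using mult_left_mono[of 2 "real v" "real u"] 3 by simp
    then have un: "u < n"
      using large[of "2 * u"] \<open>u \<ge> 1\<close> by linarith
    obtain q where q: "Poly_Mapping.keys q \<subseteq> normal_words g u" and pq: "p - q \<in> unitary_ideal g"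
      using reducible_degree[of g p] assms(1-3) by (auto simp: reducible_def)
    have "q = 0"
    proof (rule ccontr)
      assume "q \<noteq> 0"
      define d where "d = Max ((\<lambda>w. length (letters w)) ` Poly_Mapping.keys q)"
      have ne: "(\<lambda>w. length (letters w)) ` Poly_Mapping.keys q \<noteq> {}"
        using \<open>q \<noteq> 0\<close> by simp
      obtain w0 where w0: "w0 \<in> Poly_Mapping.keys q" "length (letters w0) = d"
        using Max_in[OF _ ne] unfolding d_def by auto
      have le: "length (letters w) \<le> d" if "w \<in> Poly_Mapping.keys q" for w
        using that unfolding d_def by (intro Max_ge) auto
      have qd: "Poly_Mapping.keys q \<subseteq> normal_words g d"
      proof
        fix w assume "w \<in> Poly_Mapping.keys q"
        then show "w \<in> normal_words g d"
          using q le[of w] by (auto simp: normal_words_def)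
      qed
      have "d \<le> u"
        using q w0 by (auto simp: normal_words_def)
      then have dn: "d < n" using un by simp
      have "poly_entry n E q 0 d = 0" if E: "inverse_pair_rep g n E" for E
        using van[OF E, of 0 d] unitary_ideal_vanishes[OF E pq, of 0 d] dn by (simp add: poly_entry_diff)
      then have "Poly_Mapping.lookup q (Word (letters w0)) = 0"
        using top_coefficient_zero[OF \<open>g > 1\<close> dn qd, of "letters w0"] qd w0 by auto
      then show False
        using w0(1) by (simp add: in_keys_iff)
    qed
    then show ?thesis using pq by simp
  qed
qed

end
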